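(* Let $f:\mathbb{R}^n\to\mathbb{R}^n$ be a polynomial vector field of degree $q$ with $f(0)=0$, let $M\subset B_r$ be a bounded nonempty region of radius $r>0$, let $\lambda>0$, $K\ge1$, and let $2d$ be a degree bound associated with $(f,q,r,K,\lambda)$ as defined in the context. Put $D=\frac{(n+d)!}{n!\,d!}$ and let $Z(x)\in\mathbb{R}^D$ be the vector of all monomials in $x=(x_1,\dots,x_n)$ of degree $d$ or less. If the system $\dot x=f(x)$ is exponentially stable on $M$ with decay rate $\lambda$ or greater, in the sense that for every $x(0)\in M$ the solution exists for all $t\ge0$ and satisfies $\|x(t)\|\le K\|x(0)\|e^{-\lambda t}$ for all $t\ge 0$, then for some $\alpha,\beta,\gamma>0$ there exists a real symmetric $D\times D$ matrix $P$ such that $$P\ge 0,$$ $$\alpha\|x\|^2\le Z(x)^TPZ(x)\le\beta\|x\|^2\qquad\text{for all }x\in M,$$ $$\nabla\left(Z(x)^TPZ(x)\right)^Tf(x)\le-\gamma\|x\|^2\qquad\text{for all }x\in M .$$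
   Context: $\|\cdot\|$ is the Euclidean norm, $B_\rho$ is the Euclidean ball of radius $\rho$ centered at $0$ in $\mathbb{R}^n$, $\log$ is the natural logarithm, and $P\ge0$ means positive semidefinite. Degree bound: let $L>0$ be a Lipschitz constant of $f$ on $B_{4Kr}$; let $T>0$ and the integer $N$ be such that $T<\frac1{2L}$ and $NT>\frac{\log(2K^2)}{2\lambda}$; let $c(k)=\sum_{i=0}^{N-1}\left(e^{TL}+K(TL)^k\right)^iK^2(TL)^k$; and let $k$ be an integer such that $c(k)<K$, $$c(k)^2+\frac{\log(2K^2)}{2\lambda}K\frac{(TL)^k}{T}(1+c(k))(K+c(k))<\frac12,\qquad c(k)^2<\frac{\lambda}{KL\log(2K^2)}\left(1-(2K^2)^{-L/\lambda}\right).$$ For any such choice of $L,T,N,k$, the associated degree bound is $2d$ with $d=q^{(Nk-1)}$. *)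

theory Defs
  imports "HOL-Analysis.Analysis" "Jordan_Normal_Form.Matrix"
begin

text \<open>
  Both imported libraries use the symbols for component selection and for the inner product;
  here they denote the operations of HOL-Analysis.
\<close>

no_notation Matrix.vec_index (infixl \<open>$\<close> 100)
no_notation Matrix.scalar_prod (infix \<open>\<bullet>\<close> 70)
unbundle inner_syntax

text \<open>
  A monomial in \<open>x\<^sub>1, \<dots>, x\<^sub>n\<close> is represented by its exponent function; \<open>n\<close> is the cardinality
  of the index type.
\<close>

definition exponents :: "nat \<Rightarrow> ('n::finite \<Rightarrow> nat) set" where
  "exponents d = {a. (\<Sum>i\<in>UNIV. a i) \<le> d}"

definition monomial :: "('n::finite \<Rightarrow> nat) \<Rightarrow> real ^ 'n \<Rightarrow> real" where
  "monomial a x = (\<Prod>i\<in>UNIV. (x $ i) ^ a i)"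

text \<open>
  The coefficients \<open>c a\<close> are vectors, so the degree is the largest total degree occurring in
  any component. The zero field has degree \<open>0\<close>.
\<close>

definition polynomial_field_of_degree :: "nat \<Rightarrow> (real ^ 'n \<Rightarrow> real ^ 'n::finite) \<Rightarrow> bool" where
  "polynomial_field_of_degree q f \<longleftrightarrow>
     (\<exists>c. (\<forall>x. f x = (\<Sum>a\<in>exponents q. monomial a x *\<^sub>R c a)) \<and>
          (q = 0 \<or> (\<exists>a. (\<Sum>i\<in>UNIV. a i) = q \<and> c a \<noteq> 0)))"

definition picard_error :: "real \<Rightarrow> real \<Rightarrow> real \<Rightarrow> nat \<Rightarrow> nat \<Rightarrow> real" where
  "picard_error K L T N k = (\<Sum>i<N. (exp (T * L) + K * (T * L) ^ k) ^ i * K\<^sup>2 * (T * L) ^ k)"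

text \<open>
  Taking \<open>N\<close> and \<open>k\<close> to be natural numbers is no restriction: for \<open>K \<ge> 1\<close> and \<open>\<lambda> > 0\<close>,
  \<open>N T > ln (2 K\<^sup>2) / (2 \<lambda>) > 0\<close> forces \<open>N \<ge> 1\<close>, and since \<open>T L < 1\<close>, an exponent \<open>k \<le> 0\<close> would
  make the first summand of \<open>picard_error\<close> at least \<open>K\<^sup>2 \<ge> K\<close>. Hence also \<open>N * k \<ge> 1\<close>, so that
  the subtraction below is not truncated.
\<close>

definition degree_bound ::
    "(real ^ 'n \<Rightarrow> real ^ 'n::finite) \<Rightarrow> nat \<Rightarrow> real \<Rightarrow> real \<Rightarrow> real \<Rightarrow> nat \<Rightarrow> bool" where
  "degree_bound f q r K lam b \<longleftrightarrow>
     (\<exists>L T :: real. \<exists>N k :: nat.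
        L > 0 \<and> L-lipschitz_on (cball 0 (4 * K * r)) f \<and>
        T > 0 \<and> T < 1 / (2 * L) \<and>
        real N * T > ln (2 * K\<^sup>2) / (2 * lam) \<and>
        picard_error K L T N k < K \<and>
        (picard_error K L T N k)\<^sup>2
          + ln (2 * K\<^sup>2) / (2 * lam) * K * ((T * L) ^ k / T)
              * (1 + picard_error K L T N k) * (K + picard_error K L T N k) < 1 / 2 \<and>
        (picard_error K L T N k)\<^sup>2
          < lam / (K * L * ln (2 * K\<^sup>2)) * (1 - (2 * K\<^sup>2) powr (- L / lam)) \<and>
        b = 2 * q ^ (N * k - 1))"

definition solution_from ::
    "(real ^ 'n \<Rightarrow> real ^ 'n::finite) \<Rightarrow> real ^ 'n \<Rightarrow> (real \<Rightarrow> real ^ 'n) \<Rightarrow> bool" where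
  "solution_from f x0 x \<longleftrightarrow>
     x 0 = x0 \<and> (\<forall>t\<ge>0. (x has_vector_derivative f (x t)) (at t within {0..}))"

text \<open>
  Polynomial fields are locally Lipschitz, so the solution is unique on \<open>t \<ge> 0\<close> and it makes no
  difference that it is quantified existentially.
\<close>

definition exp_stable_on ::
    "(real ^ 'n \<Rightarrow> real ^ 'n::finite) \<Rightarrow> (real ^ 'n) set \<Rightarrow> real \<Rightarrow> real \<Rightarrow> bool" where
  "exp_stable_on f M K lam \<longleftrightarrow>
     (\<forall>x0\<in>M. \<exists>x. solution_from f x0 x \<and>
        (\<forall>t\<ge>0. norm (x t) \<le> K * norm x0 * exp (- lam * t)))"

definition psd_mat :: "nat \<Rightarrow> real mat \<Rightarrow> bool" where
  "psd_mat m P \<longleftrightarrow> (\<forall>v\<in>carrier_vec m. 0 \<le> scalar_prod v (P *\<^sub>v v))"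

text \<open>
  The vector of the monomials with exponents \<open>e 0, \<dots>, e (m - 1)\<close>.
\<close>

definition monomial_vec ::
    "nat \<Rightarrow> (nat \<Rightarrow> 'n::finite \<Rightarrow> nat) \<Rightarrow> real ^ 'n \<Rightarrow> real Matrix.vec" where
  "monomial_vec m e x = Matrix.vec m (\<lambda>i. monomial (e i) x)"

definition quadratic_form :: "real mat \<Rightarrow> real Matrix.vec \<Rightarrow> real" where
  "quadratic_form P z = scalar_prod z (P *\<^sub>v z)"

text \<open>
  There are \<open>(n + d)! / (n! d!)\<close> monomials of degree at most \<open>d\<close>, so they can be enumerated
  by \<open>{..<(n + d)! / (n! d!)}\<close>.
\<close>

lemma card_exponents:
  "finite (exponents d :: ('n::finite \<Rightarrow> nat) set)"
  "card (exponents d :: ('n \<Rightarrow> nat) set) = fact (CARD('n) + d) div (fact CARD('n) * fact d)"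
proof -
  let ?n = "CARD('n)"
  let ?E = "exponents d :: ('n \<Rightarrow> nat) set"
  let ?S = "{l::nat list. length l = ?n + 1 \<and> sum_list l = d}"
  obtain h :: "nat \<Rightarrow> 'n" where h: "bij_betw h {0..<?n} UNIV"
    using ex_bij_betw_nat_finite[of "UNIV :: 'n set"] by auto
  define F where "F a = (d - (\<Sum>i\<in>UNIV. a i)) # map (a \<circ> h) [0..<?n]" for a :: "'n \<Rightarrow> nat"
  have sumh: "sum_list (map (a \<circ> h) [0..<?n]) = (\<Sum>i\<in>UNIV. a i)" for a :: "'n \<Rightarrow> nat"
    using sum.reindex_bij_betw[OF h, of a] by (simp add: interv_sum_list_conv_sum_set_nat)
  have "inj_on F ?E"
  proof (rule inj_onI)
    fix a b assume "F a = F b"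
    then have *: "\<And>j. j < ?n \<Longrightarrow> a (h j) = b (h j)" by (auto simp: F_def)
    show "a = b"
    proof
      fix i
      have "i \<in> h ` {0..<?n}" using h by (simp add: bij_betw_def)
      then obtain j where "j < ?n" "h j = i" by auto
      then show "a i = b i" using * by auto
    qed
  qed
  moreover have "F ` ?E = ?S"
  proof
    show "F ` ?E \<subseteq> ?S" using sumh by (auto simp: F_def exponents_def)
    show "?S \<subseteq> F ` ?E"
    proof
      fix l assume l: "l \<in> ?S"
      then obtain y ys where ys: "l = y # ys" "length ys = ?n" "y + sum_list ys = d"
        by (cases l) auto
      define a where "a i = ys ! (inv_into {0..<?n} h i)" for i
      have "a (h j) = ys ! j" if "j < ?n" for j
        using that h by (auto simp: a_def bij_betw_def)
      then have m: "map (a \<circ> h) [0..<?n] = ys"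
        using ys(2) by (intro nth_equalityI) auto
      with sumh[of a] have "(\<Sum>i\<in>UNIV. a i) = sum_list ys" by simp
      then have "a \<in> ?E" "F a = l"
        using ys m by (auto simp: exponents_def F_def)
      then show "l \<in> F ` ?E" by blast
    qed
  qed
  ultimately have b: "bij_betw F ?E ?S" by (simp add: bij_betw_def)
  have "card ?S = (?n + d) choose d"
    by (simp add: card_length_sum_list add.commute)
  moreover have "(?n + d) choose d > 0" by simp
  ultimately have "finite ?S" using card_ge_0_finite by metis
  with b show "finite ?E" by (simp add: bij_betw_finite)
  show "card ?E = fact (?n + d) div (fact ?n * fact d)"
    using bij_betw_same_card[OF b] \<open>card ?S = _\<close>
    by (simp add: binomial_fact' mult.commute)
qed

end

theory Submission
  imports Defs
begin

text \<open>
  Put \<open>\<delta> = ln (2 K\<^sup>2) / (2 \<lambda>)\<close>, so that \<open>K exp (- \<lambda> \<delta>) = 1 / sqrt 2\<close>, and let \<open>\<phi>\<close> be the flow. The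
  function \<open>\<integral>\<^sub>0\<^sup>\<delta> |\<phi>(x, s)|\<^sup>2 ds\<close> has derivative \<open>|\<phi>(x, \<delta>)|\<^sup>2 - |x|\<^sup>2 \<le> - |x|\<^sup>2 / 2\<close> along the field.
  The flow is replaced by a Picard iterate \<open>Z\<close> with \<open>N k - 1\<close> compositions with \<open>f\<close>, a polynomial in
  \<open>x\<close> of degree at most \<open>d\<close>; then \<open>V(x) = \<integral>\<^sub>0\<^sup>\<delta> |Z(x, s)|\<^sup>2 ds\<close> has a Gram matrix. Two errors have
  to be controlled: \<open>Z - \<phi>\<close>, and the failure \<open>\<partial>\<^sub>s Z - D\<^sub>x Z f(x)\<close> of \<open>Z\<close> to be a flow.

  Instead of restarting the iteration on \<open>N\<close> intervals of length \<open>T\<close>, a single iteration is run on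
  \<open>[0, \<delta>]\<close>. If \<open>L \<delta> \<le> 2\<close>, it converges factorially and never leaves the ball of radius \<open>4 K r\<close>, where
  \<open>L\<close> is a Lipschitz constant. If \<open>L \<delta> > 2\<close>, the \<open>j\<close>-th iterate is frozen after a time that
  grows linearly in \<open>j\<close>. This keeps it in the ball, and the errors are at most
  \<open>\<kappa>\<^sup>-\<^sup>j exp (3 L s)\<close> up to constants, with \<open>\<kappa> = 3\<close> and \<open>\<kappa> = 5/2\<close>. The hypotheses on \<open>T\<close>,
  \<open>N\<close>, \<open>k\<close> give \<open>N k \<ge> 2.7 L \<delta> (L \<delta> + 2 ln K + 0.6)\<close> in this case, which is ample.
\<close>

section \<open>Polynomial families with time-dependent coefficients\<close>

text \<open>The degree counts \<open>x\<close> only. In \<open>s\<close> mere continuity is asked,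
  because freezing at a finite time destroys a polynomial dependence on \<open>s\<close>, and only
  on \<open>s \<ge> 0\<close>, where all integrals live.\<close>

definition poly_family ::
    "nat \<Rightarrow> (real ^ 'n::finite \<Rightarrow> real \<Rightarrow> 'b::real_normed_vector) \<Rightarrow> bool" where
  "poly_family d F \<longleftrightarrow> (\<exists>c. (\<forall>a. continuous_on {0..} (c a)) \<and>
     (\<forall>x s. s \<ge> 0 \<longrightarrow> F x s = (\<Sum>a\<in>exponents d. monomial a x *\<^sub>R c a s)))"

lemma finite_exponents [simp]: "finite (exponents d)"
  by (rule card_exponents)

lemma exponents_mono: "d \<le> d' \<Longrightarrow> exponents d \<subseteq> exponents d'"
  by (auto simp: exponents_def)

lemma monomial_add: "monomial (\<lambda>i. a i + b i) x = monomial a x * monomial b x"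
  by (simp add: monomial_def power_add prod.distrib)

lemma monomial_zero [simp]: "monomial (\<lambda>i. 0) x = 1"
  by (simp add: monomial_def)

lemma monomial_single: "monomial (\<lambda>j. if j = i then 1 else 0) x = x $ i"
proof -
  have "monomial (\<lambda>j. if j = i then 1 else 0) x = (\<Prod>j\<in>UNIV. if j = i then x $ j else 1)"
    unfolding monomial_def by (intro prod.cong) auto
  then show ?thesis by simp
qed

text \<open>The introduction rule behind the closure properties: the exponents \<open>e i\<close>
  may repeat, and coefficients with equal exponents are collected into one.\<close>

lemma poly_family_indexed_sum:
  assumes "finite I" and e: "\<And>i. i \<in> I \<Longrightarrow> e i \<in> exponents d"
    and c: "\<And>i. i \<in> I \<Longrightarrow> continuous_on {0..} (c i)"
    and F: "\<And>x s. s \<ge> 0 \<Longrightarrow> F x s = (\<Sum>i\<in>I. monomial (e i) x *\<^sub>R c i s)"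
  shows "poly_family d F"
proof -
  define c' where "c' a s = (\<Sum>i\<in>{i\<in>I. e i = a}. c i s)" for a s
  have "continuous_on {0..} (c' a)" for a
    unfolding c'_def using c by (intro continuous_on_sum) auto
  moreover have "F x s = (\<Sum>a\<in>exponents d. monomial a x *\<^sub>R c' a s)" if "s \<ge> 0" for x s
  proof -
    have "F x s = (\<Sum>a\<in>exponents d. \<Sum>i\<in>{i\<in>I. e i = a}. monomial (e i) x *\<^sub>R c i s)"
      using F[OF that] e \<open>finite I\<close> by (subst sum.group) auto
    also have "\<dots> = (\<Sum>a\<in>exponents d. monomial a x *\<^sub>R c' a s)"
      by (simp add: c'_def scaleR_sum_right)
    finally show ?thesis .
  qed
  ultimately show ?thesis unfolding poly_family_def by blast
qed

lemma poly_family_const: "continuous_on {0..} c \<Longrightarrow> poly_family d (\<lambda>x s. c s)"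
  by (rule poly_family_indexed_sum[where I = "{()}" and e = "\<lambda>_ _. 0" and c = "\<lambda>_. c"])
    (auto simp: exponents_def)

lemma poly_family_identity: "poly_family 1 (\<lambda>x s. x :: real ^ 'n::finite)"
proof (rule poly_family_indexed_sum[where I = UNIV and e = "\<lambda>i j. if j = i then 1 else 0"
      and c = "\<lambda>i s. axis i (1::real)"])
  fix x :: "real ^ 'n" and s :: real
  show "x = (\<Sum>i\<in>UNIV. monomial (\<lambda>j. if j = i then 1 else 0) x *\<^sub>R axis i 1)"
    unfolding monomial_single using basis_expansion[of x] by (simp add: scalar_mult_eq_scaleR)
qed (auto simp: exponents_def)

lemma poly_family_mono:
  assumes "poly_family d F" "d \<le> d'"
  shows "poly_family d' F"
proof -
  obtain c where c: "\<And>a. continuous_on {0..} (c a)"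
      "\<And>x s. s \<ge> 0 \<Longrightarrow> F x s = (\<Sum>a\<in>exponents d. monomial a x *\<^sub>R c a s)"
    using assms(1) unfolding poly_family_def by blast
  show ?thesis
    by (rule poly_family_indexed_sum[where I = "exponents d" and e = "\<lambda>a. a" and c = c])
      (use c exponents_mono[OF assms(2)] in auto)
qed

lemma poly_family_add:
  assumes "poly_family d F" "poly_family d G"
  shows "poly_family d (\<lambda>x s. F x s + G x s)"
proof -
  obtain b where b: "\<And>a. continuous_on {0..} (b a)"
      "\<And>x s. s \<ge> 0 \<Longrightarrow> F x s = (\<Sum>a\<in>exponents d. monomial a x *\<^sub>R b a s)"
    using assms(1) unfolding poly_family_def by blast
  obtain c where c: "\<And>a. continuous_on {0..} (c a)"
      "\<And>x s. s \<ge> 0 \<Longrightarrow> G x s = (\<Sum>a\<in>exponents d. monomial a x *\<^sub>R c a s)"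
    using assms(2) unfolding poly_family_def by blast
  show ?thesis
    by (rule poly_family_indexed_sum[where I = "exponents d" and e = "\<lambda>a. a"
          and c = "\<lambda>a s. b a s + c a s"])
      (use b c in \<open>auto intro!: continuous_intros simp: scaleR_add_right sum.distrib\<close>)
qed

lemma poly_family_sum:
  assumes "finite I" "\<And>i. i \<in> I \<Longrightarrow> poly_family d (F i)"
  shows "poly_family d (\<lambda>x s. \<Sum>i\<in>I. F i x s)"
  using assms
  by (induction rule: finite_induct)
    (auto intro: poly_family_const poly_family_add)

lemma poly_family_scaleR:
  fixes F :: "real ^ 'n::finite \<Rightarrow> real \<Rightarrow> real" and G :: "real ^ 'n \<Rightarrow> real \<Rightarrow> 'b::real_normed_vector"
  assumes "poly_family d F" "poly_family d' G"
  shows "poly_family (d + d') (\<lambda>x s. F x s *\<^sub>R G x s)"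
proof -
  obtain b where b: "\<And>a. continuous_on {0..} (b a)"
      "\<And>x s. s \<ge> 0 \<Longrightarrow> F x s = (\<Sum>a\<in>exponents d. monomial a x *\<^sub>R b a s)"
    using assms(1) unfolding poly_family_def by blast
  obtain c where c: "\<And>a. continuous_on {0..} (c a)"
      "\<And>x s. s \<ge> 0 \<Longrightarrow> G x s = (\<Sum>a\<in>exponents d'. monomial a x *\<^sub>R c a s)"
    using assms(2) unfolding poly_family_def by blast
  show ?thesis
  proof (rule poly_family_indexed_sum[where I = "exponents d \<times> exponents d'"
        and e = "\<lambda>(p, p') i. p i + p' i" and c = "\<lambda>(p, p') s. b p s *\<^sub>R c p' s"])
    fix x :: "real ^ 'n" and s :: real assume s: "0 \<le> s"
    have "F x s *\<^sub>R G x s = (\<Sum>p\<in>exponents d. \<Sum>p'\<in>exponents d'.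
        (monomial p x *\<^sub>R b p s) *\<^sub>R (monomial p' x *\<^sub>R c p' s))"
      unfolding b(2)[OF s] c(2)[OF s] by (subst scaleR_sum_left) (simp only: scaleR_sum_right)
    then show "F x s *\<^sub>R G x s = (\<Sum>i\<in>exponents d \<times> exponents d'.
            monomial (case i of (p, p') \<Rightarrow> \<lambda>i. p i + p' i) x *\<^sub>R (case i of (p, p') \<Rightarrow> \<lambda>s. b p s *\<^sub>R c p' s) s)"
      by (simp add: sum.cartesian_product split_def monomial_add mult_ac)
  next
    fix i assume "i \<in> (exponents d :: ('n \<Rightarrow> nat) set) \<times> (exponents d' :: ('n \<Rightarrow> nat) set)"
    then show "continuous_on {0..} (case i of (p, p') \<Rightarrow> \<lambda>s. b p s *\<^sub>R c p' s)"
      by (auto intro!: continuous_intros b(1) c(1) split: prod.split)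
  next
    show "(case i of (p, p') \<Rightarrow> \<lambda>i. p i + p' i) \<in> exponents (d + d')"
      if "i \<in> (exponents d :: ('n \<Rightarrow> nat) set) \<times> (exponents d' :: ('n \<Rightarrow> nat) set)" for i
      using that by (auto simp: exponents_def sum.distrib intro: add_mono)
  qed simp
qed

lemma poly_family_mult:
  fixes F G :: "real ^ 'n::finite \<Rightarrow> real \<Rightarrow> real"
  assumes "poly_family d F" "poly_family d' G"
  shows "poly_family (d + d') (\<lambda>x s. F x s * G x s)"
  using poly_family_scaleR[OF assms] by simp

lemma poly_family_power:
  fixes F :: "real ^ 'n::finite \<Rightarrow> real \<Rightarrow> real"
  assumes "poly_family d F"
  shows "poly_family (k * d) (\<lambda>x s. F x s ^ k)"
  by (induction k) (auto intro: poly_family_const poly_family_mult[OF assms])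

lemma poly_family_prod:
  fixes F :: "'i \<Rightarrow> real ^ 'n::finite \<Rightarrow> real \<Rightarrow> real"
  assumes "finite I" "\<And>i. i \<in> I \<Longrightarrow> poly_family (d i) (F i)"
  shows "poly_family (\<Sum>i\<in>I. d i) (\<lambda>x s. \<Prod>i\<in>I. F i x s)"
  using assms
  by (induction rule: finite_induct)
    (auto intro: poly_family_const poly_family_mult)

lemma poly_family_linear:
  assumes "poly_family d F" "bounded_linear h"
  shows "poly_family d (\<lambda>x s. h (F x s))"
proof -
  interpret h: bounded_linear h by fact
  obtain c where c: "\<And>a. continuous_on {0..} (c a)"
      "\<And>x s. s \<ge> 0 \<Longrightarrow> F x s = (\<Sum>a\<in>exponents d. monomial a x *\<^sub>R c a s)"
    using assms(1) unfolding poly_family_def by blast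
  show ?thesis
    by (rule poly_family_indexed_sum[where I = "exponents d" and e = "\<lambda>a. a"
          and c = "\<lambda>a s. h (c a s)"])
      (use c in \<open>auto intro!: h.continuous_on simp: h.sum h.scaleR\<close>)
qed

lemma poly_family_inner:
  fixes F G :: "real ^ 'n::finite \<Rightarrow> real \<Rightarrow> real ^ 'm::finite"
  assumes "poly_family d F" "poly_family d' G"
  shows "poly_family (d + d') (\<lambda>x s. F x s \<bullet> G x s)"
  unfolding inner_vec_def inner_real_def
  by (intro poly_family_sum poly_family_mult poly_family_linear[OF assms(1) bounded_linear_vec_nth]
      poly_family_linear[OF assms(2) bounded_linear_vec_nth]) auto

lemma poly_family_compose:
  assumes f: "\<And>y. f y = (\<Sum>a\<in>exponents q. monomial a y *\<^sub>R c a)"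
    and F: "poly_family d F"
  shows "poly_family (q * d) (\<lambda>x s. f (F x s))"
  unfolding f
proof (rule poly_family_sum)
  fix a :: "'a \<Rightarrow> nat" assume "a \<in> exponents q"
  \<comment> \<open>The \<open>0\<close> is the degree of the constant \<open>c a\<close>, in the
    shape in which \<open>poly_family_scaleR\<close> returns it.\<close>
  then have le: "(\<Sum>i\<in>UNIV. a i * d) + 0 \<le> q * d"
    by (simp add: exponents_def flip: sum_distrib_right)
  have "poly_family (\<Sum>i\<in>UNIV. a i * d) (\<lambda>x s. monomial a (F x s))"
    unfolding monomial_def
    by (intro poly_family_prod poly_family_power poly_family_linear[OF F bounded_linear_vec_nth]) auto
  then show "poly_family (q * d) (\<lambda>x s. monomial a (F x s) *\<^sub>R c a)"
    by (rule poly_family_mono[OF poly_family_scaleR[OF _ poly_family_const] le]) simp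
qed simp

text \<open>Integration acts on the coefficients alone, so neither it nor the stopping at time
  \<open>t\<close> changes the degree in \<open>x\<close>.\<close>

lemma poly_family_integral_min:
  fixes F :: "real ^ 'n::finite \<Rightarrow> real \<Rightarrow> 'b::banach"
  assumes "poly_family d F" and t: "t \<ge> 0"
  shows "poly_family d (\<lambda>x s. integral {0..min s t} (F x))"
proof -
  obtain c where c: "\<And>a. continuous_on {0..} (c a)"
      "\<And>x s. s \<ge> 0 \<Longrightarrow> F x s = (\<Sum>a\<in>exponents d. monomial a x *\<^sub>R c a s)"
    using assms(1) unfolding poly_family_def by blast
  have int: "c a integrable_on {0..u}" for a u
    by (intro integrable_continuous_real continuous_on_subset[OF c(1)]) auto
  show ?thesis
  proof (rule poly_family_indexed_sum[where I = "exponents d" and e = "\<lambda>a. a"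
        and c = "\<lambda>a s. integral {0..min s t} (c a)"])
    fix a
    show "continuous_on {0..} (\<lambda>s. integral {0..min s t} (c a))"
      by (rule continuous_on_compose2[OF indefinite_integral_continuous_1[OF int[of a t]]])
        (use t in \<open>auto intro!: continuous_intros\<close>)
  next
    fix x s
    have "integral {0..min s t} (F x)
        = integral {0..min s t} (\<lambda>\<sigma>. \<Sum>a\<in>exponents d. monomial a x *\<^sub>R c a \<sigma>)"
      by (rule integral_cong) (simp add: c(2))
    also have "\<dots> = (\<Sum>a\<in>exponents d. monomial a x *\<^sub>R integral {0..min s t} (c a))"
      using int by (simp add: integral_sum integrable_cmul)
    finally show "integral {0..min s t} (F x)
        = (\<Sum>a\<in>exponents d. monomial a x *\<^sub>R integral {0..min s t} (c a))" .
  qed auto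
qed

section \<open>Derivatives and Gram matrices of polynomial families\<close>

lemma monomial_differentiable: "monomial a differentiable at x"
proof -
  have "((\<lambda>x. \<Prod>i\<in>UNIV. (x $ i) ^ a i) has_derivative (\<lambda>v. \<Sum>i\<in>UNIV.
      (of_nat (a i) * v $ i * (x $ i) ^ (a i - 1)) * (\<Prod>j\<in>UNIV - {i}. (x $ j) ^ a j))) (at x)"
    by (intro has_derivative_prod has_derivative_power
        bounded_linear_imp_has_derivative bounded_linear_vec_nth)
  then show ?thesis unfolding differentiable_def monomial_def[abs_def] by blast
qed

text \<open>Differentiation acts on the monomials and integration on the coefficients of one finite
  sum, so the two commute term by term.\<close>

lemma
  fixes F :: "real ^ 'n::finite \<Rightarrow> real \<Rightarrow> 'b::banach"
  assumes F: "poly_family d F"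
  defines "F' \<equiv> \<lambda>x s. frechet_derivative (\<lambda>y. F y s) (at x)"
  shows poly_family_has_derivative: "s \<ge> 0 \<Longrightarrow> ((\<lambda>y. F y s) has_derivative F' x s) (at x)"
    and poly_family_continuous_derivative: "continuous_on {0..} (\<lambda>s. F' x s v)"
    and poly_family_integral_has_derivative: "t \<ge> 0 \<Longrightarrow>
      ((\<lambda>y. integral {0..t} (F y)) has_derivative (\<lambda>v. integral {0..t} (\<lambda>s. F' x s v))) (at x)"
    and poly_family_continuous: "continuous_on {0..} (F x)"
proof -
  obtain c where c: "\<And>a. continuous_on {0..} (c a)"
      "\<And>x s. s \<ge> 0 \<Longrightarrow> F x s = (\<Sum>a\<in>exponents d. monomial a x *\<^sub>R c a s)"
    using F unfolding poly_family_def by blast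
  have int: "c a integrable_on {0..u}" for a u
    by (intro integrable_continuous_real continuous_on_subset[OF c(1)]) auto
  define m' where "m' a x = frechet_derivative (monomial a) (at x)" for a and x :: "real ^ 'n"
  have m': "(monomial a has_derivative m' a x) (at x)" for a x
    unfolding m'_def using monomial_differentiable frechet_derivative_works by blast
  have lin: "((\<lambda>y. \<Sum>a\<in>exponents d. monomial a y *\<^sub>R k a) has_derivative
       (\<lambda>v. \<Sum>a\<in>exponents d. m' a x v *\<^sub>R k a)) (at x)" for k :: "('n \<Rightarrow> nat) \<Rightarrow> 'b" and x
    by (intro has_derivative_sum has_derivative_scaleR_left m')
  have D: "((\<lambda>y. F y s) has_derivative (\<lambda>v. \<Sum>a\<in>exponents d. m' a x v *\<^sub>R c a s)) (at x)"
    if "s \<ge> 0" for x s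
    using lin[of "\<lambda>a. c a s" x] c(2)[OF that] by simp
  have F': "F' x s = (\<lambda>v. \<Sum>a\<in>exponents d. m' a x v *\<^sub>R c a s)" if "s \<ge> 0" for x s
    unfolding F'_def by (rule frechet_derivative_at[OF D[OF that], symmetric])
  show "((\<lambda>y. F y s) has_derivative F' x s) (at x)" if "s \<ge> 0" for x s
    using D F' that by simp
  show "continuous_on {0..} (\<lambda>s. F' x s v)" for x v
    by (rule continuous_on_eq[of _ "\<lambda>s. \<Sum>a\<in>exponents d. m' a x v *\<^sub>R c a s"])
      (auto simp: F' intro!: continuous_intros c)
  show "((\<lambda>y. integral {0..t} (F y)) has_derivative
                  (\<lambda>v. integral {0..t} (\<lambda>s. F' x s v))) (at x)" if "t \<ge> 0" for x t
  proof -
    have "integral {0..t} (F y) = (\<Sum>a\<in>exponents d. monomial a y *\<^sub>R integral {0..t} (c a))" for y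
    proof -
      have "integral {0..t} (F y) = integral {0..t} (\<lambda>\<sigma>. \<Sum>a\<in>exponents d. monomial a y *\<^sub>R c a \<sigma>)"
        by (rule integral_cong) (simp add: c(2))
      then show ?thesis using int by (simp add: integral_sum integrable_cmul)
    qed
    moreover have "integral {0..t} (\<lambda>s. F' x s v)
        = (\<Sum>a\<in>exponents d. m' a x v *\<^sub>R integral {0..t} (c a))" for v
    proof -
      have "integral {0..t} (\<lambda>s. F' x s v)
          = integral {0..t} (\<lambda>s. \<Sum>a\<in>exponents d. m' a x v *\<^sub>R c a s)"
        by (rule integral_cong) (simp add: F')
      then show ?thesis using int by (simp add: integral_sum integrable_cmul)
    qed
    ultimately show ?thesis using lin by simp
  qed
  show "continuous_on {0..} (F x)" for x
    by (rule continuous_on_eq[of _ "\<lambda>s. \<Sum>a\<in>exponents d. monomial a x *\<^sub>R c a s"])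
      (auto simp: c(2) intro!: continuous_intros c)
qed

text \<open>\<open>P\<close> is the Gram matrix of the coefficient functions \<open>c (e i)\<close>
  for the inner product of square-integrable functions on \<open>{0..t}\<close>. Hence it is
  symmetric, and its form at any \<open>v\<close> is the integral of a squared norm.\<close>

lemma poly_family_gram_matrix:
  fixes F :: "real ^ 'n::finite \<Rightarrow> real \<Rightarrow> real ^ 'm::finite"
  assumes "poly_family d F" and e: "bij_betw e {..<D} (exponents d)"
  obtains P where "P \<in> carrier_mat D D" "transpose_mat P = P" "psd_mat D P"
    "\<And>x. quadratic_form P (monomial_vec D e x) = integral {0..t} (\<lambda>s. F x s \<bullet> F x s)"
proof -
  obtain c where c: "\<And>a. continuous_on {0..} (c a)"
      "\<And>x s. s \<ge> 0 \<Longrightarrow> F x s = (\<Sum>a\<in>exponents d. monomial a x *\<^sub>R c a s)"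
    using assms(1) unfolding poly_family_def by blast
  define P where "P = Matrix.mat D D (\<lambda>(i, j). integral {0..t} (\<lambda>s. c (e i) s \<bullet> c (e j) s))"
  have int: "(\<lambda>s. c a s \<bullet> c b s) integrable_on {0..t}" for a b
    by (intro integrable_continuous_real continuous_intros continuous_on_subset[OF c(1)]) auto
  have qf: "scalar_prod v (P *\<^sub>v v) = integral {0..t} (\<lambda>s.
      (\<Sum>i<D. vec_index v i *\<^sub>R c (e i) s) \<bullet> (\<Sum>i<D. vec_index v i *\<^sub>R c (e i) s))"
    if v: "v \<in> carrier_vec D" for v
  proof -
    have "scalar_prod v (P *\<^sub>v v) = (\<Sum>i<D. \<Sum>j<D. vec_index v i * (vec_index v j *
        integral {0..t} (\<lambda>s. c (e i) s \<bullet> c (e j) s)))"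
      using v by (simp add: P_def scalar_prod_def sum_distrib_left atLeast0LessThan mult_ac)
    also have "\<dots> = integral {0..t} (\<lambda>s. \<Sum>i<D. \<Sum>j<D. vec_index v i * (vec_index v j *
        (c (e i) s \<bullet> c (e j) s)))"
    proof -
      have int': "(\<lambda>s. vec_index v i * (vec_index v j * (c (e i) s \<bullet> c (e j) s))) integrable_on {0..t}"
        for i j by (intro integrable_on_mult_right int)
      show ?thesis
        using int' int by (simp add: integral_sum integrable_sum)
    qed
    also have "\<dots> = integral {0..t} (\<lambda>s.
        (\<Sum>i<D. vec_index v i *\<^sub>R c (e i) s) \<bullet> (\<Sum>i<D. vec_index v i *\<^sub>R c (e i) s))"
      unfolding inner_sum_left unfolding inner_sum_right
      by (subst sum.swap) (simp add: mult_ac inner_commute)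
    finally show ?thesis .
  qed
  show ?thesis
  proof
    show "P \<in> carrier_mat D D" by (simp add: P_def)
    show "transpose_mat P = P"
      by (rule eq_matI) (auto simp: P_def inner_commute)
    show "psd_mat D P"
      unfolding psd_mat_def by (auto simp: qf intro!: integral_nonneg integrable_continuous_real
          continuous_intros continuous_on_subset[OF c(1)])
    fix x
    have "F x s = (\<Sum>i<D. monomial (e i) x *\<^sub>R c (e i) s)" if "s \<ge> 0" for s
      using sum.reindex_bij_betw[OF e, of "\<lambda>a. monomial a x *\<^sub>R c a s"] c(2)[OF that] by simp
    then have "integral {0..t} (\<lambda>s. F x s \<bullet> F x s) = integral {0..t} (\<lambda>s.
        (\<Sum>i<D. monomial (e i) x *\<^sub>R c (e i) s) \<bullet> (\<Sum>i<D. monomial (e i) x *\<^sub>R c (e i) s))"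
      by (intro integral_cong) auto
    then show "quadratic_form P (monomial_vec D e x) = integral {0..t} (\<lambda>s. F x s \<bullet> F x s)"
      unfolding quadratic_form_def by (subst qf) (auto simp: monomial_vec_def)
  qed
qed

section \<open>Picard iteration with moving windows\<close>

text \<open>Difference quotients in direction \<open>v\<close> have norm at most
  \<open>L * norm v\<close> and tend to \<open>f' v\<close>; since \<open>y\<close> is interior,
  small steps stay in \<open>S\<close>.\<close>

lemma norm_derivative_le_lipschitz:
  fixes f :: "'a::real_normed_vector \<Rightarrow> 'b::real_normed_vector"
  assumes "L-lipschitz_on S f" "y \<in> interior S" "(f has_derivative f') (at y)"
  shows "norm (f' v) \<le> L * norm v"
proof -
  interpret f': bounded_linear f' using assms(3) by (rule has_derivative_bounded_linear)
  have "((\<lambda>h. y + h *\<^sub>R v) has_vector_derivative v) (at 0)"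
    by (auto intro!: derivative_eq_intros)
  from vector_derivative_diff_chain_within[OF this, of f f'] assms(3)
  have "((\<lambda>h. f (y + h *\<^sub>R v)) has_vector_derivative f' v) (at 0)"
    by (simp add: has_derivative_at_withinI o_def)
  then have "((\<lambda>h. (f (y + h *\<^sub>R v) - f y - h *\<^sub>R f' v) /\<^sub>R \<bar>h\<bar>) \<longlongrightarrow> 0) (at 0)"
    by (simp add: has_vector_derivative_def has_derivative_at_within)
  then have lim: "((\<lambda>h. norm ((f (y + h *\<^sub>R v) - f y - h *\<^sub>R f' v) /\<^sub>R \<bar>h\<bar>)) \<longlongrightarrow> 0) (at 0)"
    by (rule tendsto_norm_zero)
  have y: "y \<in> S" using assms(2) interior_subset by blast
  have "((\<lambda>h. y + h *\<^sub>R v) \<longlongrightarrow> y + 0 *\<^sub>R v) (at 0)"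
    by (intro tendsto_add tendsto_scaleR tendsto_const tendsto_ident_at)
  then have "\<forall>\<^sub>F h in at 0. y + h *\<^sub>R v \<in> interior S"
    by (rule topological_tendstoD) (use assms(2) in auto)
  then have ev: "\<forall>\<^sub>F h in at 0. norm (f' v) \<le>
      L * norm v + norm ((f (y + h *\<^sub>R v) - f y - h *\<^sub>R f' v) /\<^sub>R \<bar>h\<bar>)"
    using eventually_neq_at_within[of 0 0 UNIV]
  proof eventually_elim
    case (elim h)
    let ?e = "f (y + h *\<^sub>R v) - f y - h *\<^sub>R f' v"
    have "y + h *\<^sub>R v \<in> S" using elim interior_subset by blast
    then have "norm (f (y + h *\<^sub>R v) - f y) \<le> L * norm (h *\<^sub>R v)"
      using lipschitz_onD[OF assms(1) _ y, of "y + h *\<^sub>R v"] by (simp add: dist_norm)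
    then have "norm (h *\<^sub>R f' v) \<le> L * norm (h *\<^sub>R v) + norm ?e"
      using norm_triangle_ineq4[of "f (y + h *\<^sub>R v) - f y" ?e] by simp
    moreover have "\<bar>h\<bar> * norm (?e /\<^sub>R \<bar>h\<bar>) = norm ?e" using elim by simp
    ultimately have "\<bar>h\<bar> * norm (f' v) \<le> \<bar>h\<bar> * (L * norm v + norm (?e /\<^sub>R \<bar>h\<bar>))"
      by (simp only: distrib_left norm_scaleR mult.left_commute)
    then show ?case by (rule mult_left_le_imp_le) (use elim in simp)
  qed
  have "((\<lambda>h. L * norm v + norm ((f (y + h *\<^sub>R v) - f y - h *\<^sub>R f' v) /\<^sub>R \<bar>h\<bar>)) \<longlongrightarrow> L * norm v + 0) (at 0)"
    by (intro tendsto_add tendsto_const lim)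
  from tendsto_lowerbound[OF this ev] show ?thesis by simp
qed

lemma has_integral_norm_le:
  fixes u :: "real \<Rightarrow> 'b::banach"
  assumes "(u has_integral I) {a..b}" "continuous_on {a..b} g"
    and "\<And>s. s \<in> {a..b} \<Longrightarrow> norm (u s) \<le> g s"
  shows "norm I \<le> integral {a..b} g"
  using integral_norm_bound_integral[of u "{a..b}" g] assms
    integrable_continuous_real[OF assms(2)] by (auto simp: has_integral_iff)

text \<open>Turns a stopped integral into one over all of \<open>{0..s}\<close>, so that iterates
  and trajectories can be compared integrand by integrand.\<close>

lemma has_integral_truncated:
  fixes u :: "real \<Rightarrow> 'b::banach"
  assumes "continuous_on {0..} u" "0 \<le> s" "0 \<le> t"
  shows "((\<lambda>\<sigma>. if \<sigma> \<le> t then u \<sigma> else 0) has_integral integral {0..min s t} u) {0..s}"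
proof -
  have "(u has_integral integral {0..min s t} u) {0..min s t}"
    by (intro integrable_integral integrable_continuous_real continuous_on_subset[OF assms(1)]) auto
  then have "((\<lambda>\<sigma>. if \<sigma> \<in> cbox 0 (min s t) then u \<sigma> else 0) has_integral
      integral {0..min s t} u) (cbox 0 s)"
    using assms by (intro has_integral_restrict_closed_subinterval) auto
  then show ?thesis unfolding cbox_interval
    by (rule has_integral_eq[rotated]) auto
qed

text \<open>At the stopping time the derivative jumps from \<open>u t\<close> to \<open>0\<close>,
  which is why \<open>s = t\<close> is excluded.\<close>

lemma truncated_integral_has_vector_derivative:
  fixes u :: "real \<Rightarrow> 'b::banach"
  assumes u: "continuous_on {0..} u" and "0 < s" "s \<noteq> t"
  shows "((\<lambda>s. integral {0..min s t} u) has_vector_derivative (if s \<le> t then u s else 0)) (at s)"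
proof (cases "s < t")
  case True
  have "((\<lambda>s. integral {0..s} u) has_vector_derivative u s) (at s within {0..t})"
    using assms True by (intro integral_has_vector_derivative continuous_on_subset[OF u]) auto
  then have "((\<lambda>s. integral {0..s} u) has_vector_derivative u s) (at s)"
    using at_within_Icc_at[of 0 s t] True assms by simp
  then show ?thesis
    by (rule has_vector_derivative_transform_within_open[where S = "{..<t}", THEN has_vector_derivative_eq_rhs])
      (use True in auto)
next
  case False
  then have "s > t" using assms by auto
  have "((\<lambda>s. integral {0..t} u) has_vector_derivative 0) (at s)" by simp
  then show ?thesis
    by (rule has_vector_derivative_transform_within_open[where S = "{t<..}", THEN has_vector_derivative_eq_rhs])
      (use \<open>s > t\<close> in auto)
qed

text \<open>Picard iteration for the flow through \<open>x\<close>, with the iterate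
  \<open>Suc j\<close> frozen from time \<open>t j\<close> on. Constant windows of the full length
  give the ordinary iteration.\<close>

primrec picard :: "(real ^ 'n::finite \<Rightarrow> real ^ 'n) \<Rightarrow> (nat \<Rightarrow> real) \<Rightarrow> nat \<Rightarrow>
    real ^ 'n \<Rightarrow> real \<Rightarrow> real ^ 'n" where
  "picard f t 0 = (\<lambda>x s. x)"
| "picard f t (Suc j) = (\<lambda>x s. x + integral {0..min s (t j)} (\<lambda>\<sigma>. f (picard f t j x \<sigma>)))"

text \<open>The factor \<open>4\<close> leaves room: trajectories stay in radius
  \<open>K * r\<close> and iterates, until their window ends, in radius \<open>3 * K * r\<close>, so
  \<open>f'\<close> is bounded by \<open>L\<close> along both. The condition
  \<open>q \<ge> 1\<close> keeps the start value \<open>x\<close> within the degree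
  \<open>q ^ j\<close> of the iterates.\<close>

locale polynomial_field =
  fixes f :: "real ^ 'n::finite \<Rightarrow> real ^ 'n" and f' :: "real ^ 'n \<Rightarrow> real ^ 'n \<Rightarrow> real ^ 'n"
    and c :: "('n \<Rightarrow> nat) \<Rightarrow> real ^ 'n" and q :: nat and L K r \<delta> :: real
  assumes f_poly: "f y = (\<Sum>a\<in>exponents q. monomial a y *\<^sub>R c a)"
    and q: "q \<ge> 1"
    and f_derivative: "(f has_derivative f' y) (at y)"
    and f_zero: "f 0 = 0"
    and lipschitz: "L-lipschitz_on (cball 0 (4 * K * r)) f"
    and L: "L > 0" and K: "K \<ge> 1" and r: "r > 0" and \<delta>: "\<delta> > 0"
begin

lemma continuous_f: "continuous_on S f"
  by (intro continuous_at_imp_continuous_on ballI has_derivative_continuous[OF f_derivative])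

lemma norm_f_le: "norm y \<le> 4 * K * r \<Longrightarrow> norm (f y) \<le> L * norm y"
  using lipschitz_onD[OF lipschitz, of y 0] K r by (simp add: f_zero)

lemma norm_f'_le:
  assumes "norm y < 4 * K * r"
  shows "norm (f' y v) \<le> L * norm v"
  using norm_derivative_le_lipschitz[OF lipschitz _ f_derivative] assms by simp

end

text \<open>
  Relative to \<open>|x|\<close>, \<open>B j s\<close> will bound the distance at time \<open>s\<close> of the \<open>j\<close>-th iterate from the
  trajectory through \<open>x\<close>, and \<open>C j s\<close> the error \<open>\<partial>\<^sub>s Z - D\<^sub>x Z f(x)\<close> of the next iterate \<open>Z\<close>. On
  \<open>s \<le> t j\<close> the sharper bound \<open>C'\<close> holds; it leaves room for the jump \<open>3 K L\<close> of this error at the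
  freezing time \<open>t j\<close>.
\<close>

locale windowed_picard = polynomial_field f f' c q L K r \<delta>
  for f f' and c :: "('n::finite \<Rightarrow> nat) \<Rightarrow> real ^ 'n" and q L K r \<delta> +
  fixes t :: "nat \<Rightarrow> real" and B C C' :: "nat \<Rightarrow> real \<Rightarrow> real"
  assumes t_nonneg: "t j \<ge> 0"
    and B_cont: "continuous_on {0..\<delta>} (B j)"
    and B_0: "0 \<le> s \<Longrightarrow> s \<le> \<delta> \<Longrightarrow> K * L * s \<le> B 0 s"
    and B_Suc: "0 \<le> s \<Longrightarrow> s \<le> \<delta> \<Longrightarrow> L * integral {0..s} (B j) \<le> B (Suc j) s"
    and B_before: "0 \<le> s \<Longrightarrow> s \<le> \<delta> \<Longrightarrow> s \<le> t j \<Longrightarrow> B j s \<le> 2 * K"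
    and B_after: "t j < s \<Longrightarrow> s \<le> \<delta> \<Longrightarrow> K \<le> B j s"
    and C_cont: "continuous_on {0..\<delta>} (C j)"
    and C'_0: "0 \<le> s \<Longrightarrow> s \<le> \<delta> \<Longrightarrow> L\<^sup>2 * s \<le> C' 0 s"
    and C'_Suc: "0 \<le> s \<Longrightarrow> s \<le> \<delta> \<Longrightarrow> L * integral {0..s} (C j) \<le> C' (Suc j) s"
    and C_ge: "0 \<le> s \<Longrightarrow> s \<le> \<delta> \<Longrightarrow> C' j s \<le> C j s"
    and C_after: "t j < s \<Longrightarrow> s \<le> \<delta> \<Longrightarrow> C' j (t j) + 3 * K * L \<le> C j s"
begin

abbreviation Z where "Z \<equiv> picard f t"

definition dZ :: "nat \<Rightarrow> real ^ 'n \<Rightarrow> real \<Rightarrow> real ^ 'n \<Rightarrow> real ^ 'n" where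
  "dZ j x s = frechet_derivative (\<lambda>y. Z j y s) (at x)"

text \<open>The velocity of the iterate \<open>Suc j\<close>, not of the iterate \<open>j\<close>;
  it drops to \<open>0\<close> after the freezing time \<open>t j\<close>.\<close>

definition F :: "nat \<Rightarrow> real ^ 'n \<Rightarrow> real \<Rightarrow> real ^ 'n" where
  "F j x s = (if s \<le> t j then f (Z j x s) else 0)"

lemma q_power: "q ^ j \<ge> 1"
  using q by simp

lemma poly_family_Z: "poly_family (q ^ j) (Z j)"
proof (induction j)
  case 0
  show ?case using poly_family_identity by simp
next
  case (Suc j)
  have "poly_family (q * q ^ j) (\<lambda>x s. x + integral {0..min s (t j)} (\<lambda>\<sigma>. f (Z j x \<sigma>)))"
    using q_power[of "Suc j"]
    by (intro poly_family_add poly_family_integral_min t_nonneg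
        poly_family_compose[OF f_poly Suc] poly_family_mono[OF poly_family_identity]) auto
  then show ?case by simp
qed

lemma continuous_Z: "continuous_on {0..} (Z j x)"
  by (rule poly_family_continuous[OF poly_family_Z])

lemma continuous_fZ: "continuous_on {0..} (\<lambda>s. f (Z j x s))"
  by (rule continuous_on_compose2[OF continuous_f continuous_Z]) auto

lemma Z_has_derivative: "s \<ge> 0 \<Longrightarrow> ((\<lambda>y. Z j y s) has_derivative dZ j x s) (at x)"
  unfolding dZ_def by (rule poly_family_has_derivative[OF poly_family_Z])

lemma dZ_0: "dZ 0 x s v = v"
  unfolding dZ_def by (simp add: frechet_derivative_ident flip: id_def)

lemma continuous_dZ: "continuous_on {0..} (\<lambda>s. dZ j x s v)"
  unfolding dZ_def by (rule poly_family_continuous_derivative[OF poly_family_Z])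

text \<open>The derivative in the initial value obeys a Picard step of its own: the integrand is
  that of the variational equation along the iterate \<open>j\<close>.\<close>

lemma
  shows continuous_f'_dZ: "continuous_on {0..} (\<lambda>s. f' (Z j x s) (dZ j x s v))"
    and dZ_Suc: "s \<ge> 0 \<Longrightarrow>
      dZ (Suc j) x s v = v + integral {0..min s (t j)} (\<lambda>\<sigma>. f' (Z j x \<sigma>) (dZ j x \<sigma> v))"
proof -
  define G where "G x s = frechet_derivative (\<lambda>y. f (Z j y s)) (at x)" for x s
  note fZ = poly_family_compose[OF f_poly poly_family_Z[of j]]
  note G = poly_family_has_derivative[OF fZ, folded G_def]
    poly_family_continuous_derivative[OF fZ, folded G_def]
    poly_family_integral_has_derivative[OF fZ, folded G_def]
  have eq: "G x s v = f' (Z j x s) (dZ j x s v)" if "s \<ge> 0" for s v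
  proof -
    have "((\<lambda>y. f (Z j y s)) has_derivative (\<lambda>v. f' (Z j x s) (dZ j x s v))) (at x)"
      using has_derivative_compose[OF Z_has_derivative[OF that] f_derivative] .
    then have "G x s = (\<lambda>v. f' (Z j x s) (dZ j x s v))"
      using has_derivative_unique G(1)[OF that] by blast
    then show ?thesis by simp
  qed
  show "continuous_on {0..} (\<lambda>s. f' (Z j x s) (dZ j x s v))"
    using continuous_on_eq[OF G(2)[of x v]] eq by auto
  assume s: "s \<ge> 0"
  have "((\<lambda>y. Z (Suc j) y s) has_derivative (\<lambda>v. v + integral {0..min s (t j)} (\<lambda>s. G x s v))) (at x)"
    unfolding picard.simps by (intro has_derivative_add has_derivative_ident G(3)) (use s t_nonneg in auto)
  then have "dZ (Suc j) x s = (\<lambda>v. v + integral {0..min s (t j)} (\<lambda>s. G x s v))"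
    using has_derivative_unique Z_has_derivative[OF s] by blast
  then show "dZ (Suc j) x s v = v + integral {0..min s (t j)} (\<lambda>\<sigma>. f' (Z j x \<sigma>) (dZ j x \<sigma> v))"
    using eq by (auto intro!: integral_cong)
qed

lemma Z_Suc_has_integral: "s \<ge> 0 \<Longrightarrow> (F j x has_integral Z (Suc j) x s - x) {0..s}"
  using has_integral_truncated[OF continuous_fZ _ t_nonneg] by (simp add: F_def[abs_def])

lemma dZ_Suc_has_integral:
  "s \<ge> 0 \<Longrightarrow> s \<le> t j \<Longrightarrow> ((\<lambda>\<sigma>. f' (Z j x \<sigma>) (dZ j x \<sigma> v)) has_integral dZ (Suc j) x s v - v) {0..s}"
  using dZ_Suc[of s j x v]
  by (auto simp: has_integral_iff min_def intro!: integrable_continuous_real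
      continuous_on_subset[OF continuous_f'_dZ])

lemma Z_has_vector_derivative:
  assumes "0 < s" "s \<noteq> t j"
  shows "(Z (Suc j) x has_vector_derivative F j x s) (at s)"
  unfolding picard.simps F_def
  by (rule has_vector_derivative_eq_rhs[OF has_vector_derivative_add[OF has_vector_derivative_const
          truncated_integral_has_vector_derivative[OF continuous_fZ]]])
    (use assms in auto)

text \<open>Chain rule along the iterate \<open>Suc j\<close>, whose velocity is \<open>F j\<close>.
  The kink at \<open>t j\<close> is one exceptional point of the fundamental theorem, where
  continuity is enough.\<close>

lemma f_Z_has_integral:
  assumes "s \<ge> 0"
  shows "((\<lambda>\<sigma>. f' (Z (Suc j) x \<sigma>) (F j x \<sigma>)) has_integral f (Z (Suc j) x s) - f x) {0..s}"
proof -
  have "((\<lambda>\<sigma>. f' (Z (Suc j) x \<sigma>) (F j x \<sigma>)) has_integral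
      f (Z (Suc j) x s) - f (Z (Suc j) x 0)) {0..s}"
  proof (rule fundamental_theorem_of_calculus_interior_strong[of "{t j}"])
    fix \<sigma> assume \<sigma>: "\<sigma> \<in> {0<..<s} - {t j}"
    then have "(Z (Suc j) x has_vector_derivative F j x \<sigma>) (at \<sigma>)"
      by (intro Z_has_vector_derivative) auto
    from vector_derivative_diff_chain_within[OF this, of f] f_derivative
    show "((\<lambda>s. f (Z (Suc j) x s)) has_vector_derivative f' (Z (Suc j) x \<sigma>) (F j x \<sigma>)) (at \<sigma>)"
      by (auto simp: o_def intro: has_derivative_at_withinI simp del: picard.simps)
  qed (use assms continuous_on_subset[OF continuous_fZ] in \<open>auto simp del: picard.simps\<close>)
  moreover have "Z (Suc j) x 0 = x" using t_nonneg[of j] by simp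
  ultimately show ?thesis by metis
qed

end

section \<open>Error bounds along a single trajectory\<close>

locale windowed_picard_at = windowed_picard f f' c q L K r \<delta> t B C C'
  for f f' and c :: "('n::finite \<Rightarrow> nat) \<Rightarrow> real ^ 'n" and q L K r \<delta> t B C C' +
  fixes x :: "real ^ 'n" and \<phi> :: "real \<Rightarrow> real ^ 'n"
  assumes x: "norm x \<le> r"
    and \<phi>: "s \<ge> 0 \<Longrightarrow> ((\<lambda>\<sigma>. f (\<phi> \<sigma>)) has_integral \<phi> s - x) {0..s}"
    and \<phi>_le: "s \<ge> 0 \<Longrightarrow> norm (\<phi> s) \<le> K * norm x"
begin

lemma norm_\<phi>_ball: "s \<ge> 0 \<Longrightarrow> norm (\<phi> s) \<le> K * r"
  using \<phi>_le[of s] mult_left_mono[OF x, of K] K by (auto intro: order_trans)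

lemma norm_f_\<phi>: "s \<ge> 0 \<Longrightarrow> norm (f (\<phi> s)) \<le> L * (K * norm x)"
proof -
  assume s: "s \<ge> 0"
  have "K * r > 0" using K r by simp
  then have "norm (\<phi> s) \<le> 4 * K * r" using norm_\<phi>_ball[OF s] by linarith
  then have "norm (f (\<phi> s)) \<le> L * norm (\<phi> s)" by (rule norm_f_le)
  also have "\<dots> \<le> L * (K * norm x)" using \<phi>_le[OF s] L by simp
  finally show ?thesis .
qed

lemma ball_3:
  assumes "norm y \<le> 3 * K * norm x"
  shows "norm y < 4 * K * r" "norm (f y) \<le> 3 * K * L * norm x"
proof -
  have "3 * K * norm x \<le> 3 * K * r" using x K by simp
  moreover have "K * r > 0" using K r by simp
  ultimately show *: "norm y < 4 * K * r" using assms by linarith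
  have "norm (f y) \<le> L * norm y" using norm_f_le * by simp
  also have "\<dots> \<le> L * (3 * K * norm x)" using assms L by simp
  finally show "norm (f y) \<le> 3 * K * L * norm x" by (simp add: mult_ac)
qed

text \<open>The two bounds need a joint induction. The norm bound keeps the iterate in the ball
  where \<open>f\<close> is Lipschitz, which gives the next error bound; \<open>B_before\<close>
  turns that into the next norm bound, as \<open>2 * K + K = 3 * K\<close>.\<close>

lemma picard_error_le: "0 \<le> s \<Longrightarrow> s \<le> \<delta> \<Longrightarrow> norm (Z j x s - \<phi> s) \<le> B j s * norm x"
  and picard_norm_le: "0 \<le> s \<Longrightarrow> s \<le> \<delta> \<Longrightarrow> s \<le> t j \<Longrightarrow> norm (Z j x s) \<le> 3 * K * norm x"
proof (induction j arbitrary: s)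
  case 0
  { case 1
    have "norm (\<phi> s - x) \<le> integral {0..s} (\<lambda>_. L * (K * norm x))"
      by (rule has_integral_norm_le[OF \<phi>]) (use 1 norm_f_\<phi> in auto)
    also have "\<dots> = (K * L * s) * norm x" using 1 by simp
    also have "\<dots> \<le> B 0 s * norm x" using B_0 1 by (intro mult_right_mono) auto
    finally show ?case by (simp add: norm_minus_commute)
  next
    case 2
    show ?case using K by (simp add: mult_le_cancel_right1) }
next
  case (Suc j)
  have error: "norm (Z (Suc j) x s - \<phi> s) \<le> B (Suc j) s * norm x" if 1: "0 \<le> s" "s \<le> \<delta>" for s
  proof -
    have "((\<lambda>\<sigma>. F j x \<sigma> - f (\<phi> \<sigma>)) has_integral (Z (Suc j) x s - x) - (\<phi> s - x)) {0..s}"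
      using 1 by (intro has_integral_diff \<phi> Z_Suc_has_integral)
    then have "norm ((Z (Suc j) x s - x) - (\<phi> s - x)) \<le> integral {0..s} (\<lambda>\<sigma>. L * B j \<sigma> * norm x)"
    proof (rule has_integral_norm_le)
      show "continuous_on {0..s} (\<lambda>\<sigma>. L * B j \<sigma> * norm x)"
        using 1 by (intro continuous_intros continuous_on_subset[OF B_cont]) auto
      fix \<sigma> assume \<sigma>: "\<sigma> \<in> {0..s}"
      show "norm (F j x \<sigma> - f (\<phi> \<sigma>)) \<le> L * B j \<sigma> * norm x"
      proof (cases "\<sigma> \<le> t j")
        case True
        have "norm (Z j x \<sigma>) \<le> 3 * K * norm x" using Suc(2) \<sigma> 1 True by auto
        then have "norm (Z j x \<sigma>) < 4 * K * r" by (rule ball_3)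
        moreover have "K * r > 0" using K r by simp
        then have "norm (\<phi> \<sigma>) \<le> 4 * K * r" using norm_\<phi>_ball[of \<sigma>] \<sigma> by auto
        ultimately have "norm (f (Z j x \<sigma>) - f (\<phi> \<sigma>)) \<le> L * norm (Z j x \<sigma> - \<phi> \<sigma>)"
          using lipschitz_onD[OF lipschitz, of "Z j x \<sigma>" "\<phi> \<sigma>"] by (simp add: dist_norm)
        also have "\<dots> \<le> L * (B j \<sigma> * norm x)" using Suc(1) \<sigma> 1 L by simp
        finally show ?thesis using True by (simp add: F_def)
      next
        case False
        \<comment> \<open>After the window the iterate stands still and the integrand is the
          velocity of the trajectory alone; \<open>B_after\<close> makes the same bound cover
          it.\<close>
        have "norm (f (\<phi> \<sigma>)) \<le> L * (K * norm x)" using norm_f_\<phi> \<sigma> by simp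
        also have "\<dots> \<le> L * (B j \<sigma> * norm x)"
          using B_after[of j \<sigma>] False \<sigma> 1 L by (intro mult_left_mono mult_right_mono) auto
        finally show ?thesis using False by (simp add: F_def)
      qed
    qed
    also have "\<dots> = (L * integral {0..s} (B j)) * norm x" by simp
    also have "\<dots> \<le> B (Suc j) s * norm x" using B_Suc 1 by (intro mult_right_mono) auto
    finally show ?thesis by (simp del: picard.simps)
  qed
  { case 1
    then show ?case by (rule error)
  next
    case 2
    have "norm (Z (Suc j) x s) \<le> norm (Z (Suc j) x s - \<phi> s) + norm (\<phi> s)"
      by (metis diff_add_cancel norm_triangle_ineq)
    also have "\<dots> \<le> B (Suc j) s * norm x + K * norm x"
      using error 2 \<phi>_le by (intro add_mono) auto
    also have "\<dots> \<le> 2 * K * norm x + K * norm x"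
      using B_before[of s "Suc j"] 2 by (intro add_mono mult_right_mono) auto
    finally show ?case by simp }
qed

text \<open>
  Up to time \<open>t j\<close>, both \<open>f (Z j)\<close>, by the chain rule in time, and \<open>dZ (j + 1) (f x)\<close>, by
  differentiating the recursion in \<open>x\<close>, are \<open>f x\<close> plus the integral of \<open>f' (Z j)\<close> applied to the
  corresponding quantity for \<open>j - 1\<close>. So the error obeys a linear integral inequality in which no
  modulus of continuity of \<open>f'\<close> enters.
\<close>

lemma derivative_error_le:
  assumes "0 \<le> s" "s \<le> \<delta>"
  shows "norm (F j x s - dZ (Suc j) x s (f x)) \<le> C j s * norm x"
proof -
  \<comment> \<open>Passes from the window to all times. Past \<open>t j\<close> both
    \<open>Z (Suc j)\<close> and its derivative in \<open>x\<close> are frozen, so the error is the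
    one at \<open>t j\<close> less the velocity \<open>f (Z j x (t j))\<close> lost there, of norm
    at most \<open>3 * K * L * norm x\<close>.\<close>
  have after: "norm (F j x s - dZ (Suc j) x s (f x)) \<le> C j s * norm x"
    if before: "\<And>s. 0 \<le> s \<Longrightarrow> s \<le> \<delta> \<Longrightarrow> s \<le> t j \<Longrightarrow>
          norm (f (Z j x s) - dZ (Suc j) x s (f x)) \<le> C' j s * norm x"
      and s: "0 \<le> s" "s \<le> \<delta>" for j s
  proof (cases "s \<le> t j")
    case True
    have "norm (f (Z j x s) - dZ (Suc j) x s (f x)) \<le> C' j s * norm x" using before s True .
    also have "\<dots> \<le> C j s * norm x" using C_ge s by (intro mult_right_mono) auto
    finally show ?thesis using True by (simp add: F_def)
  next
    case False
    let ?t = "t j"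
    have t: "0 \<le> ?t" "?t \<le> \<delta>" using False s t_nonneg by auto
    have "dZ (Suc j) x s (f x) = dZ (Suc j) x ?t (f x)"
      using dZ_Suc[of s j x "f x"] dZ_Suc[of ?t j x "f x"] t False s by (simp add: min_def)
    then have "norm (F j x s - dZ (Suc j) x s (f x))
        = norm ((f (Z j x ?t) - dZ (Suc j) x ?t (f x)) - f (Z j x ?t))"
      using False by (simp add: F_def)
    also have "\<dots> \<le> norm (f (Z j x ?t) - dZ (Suc j) x ?t (f x)) + norm (f (Z j x ?t))"
      by (rule norm_triangle_ineq4)
    also have "\<dots> \<le> C' j ?t * norm x + 3 * K * L * norm x"
      using before[OF t] ball_3(2)[OF picard_norm_le[OF t]] by (intro add_mono) auto
    also have "\<dots> = (C' j ?t + 3 * K * L) * norm x" by (simp add: algebra_simps)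
    also have "\<dots> \<le> C j s * norm x" using C_after False s by (intro mult_right_mono) auto
    finally show ?thesis .
  qed
  show ?thesis using assms
  proof (induction j arbitrary: s)
    case 0
    show ?case
    proof (rule after)
      fix s assume s: "0 \<le> s" "s \<le> \<delta>" "s \<le> t 0"
      have "norm x < 4 * K * r" using ball_3(1) K by (simp add: mult_le_cancel_right1)
      then have b: "norm (f' x v) \<le> L * norm v" "norm (f x) \<le> L * norm x" for v
        using norm_f'_le norm_f_le by auto
      have "norm (dZ (Suc 0) x s (f x) - f x) \<le> integral {0..s} (\<lambda>_. L * (L * norm x))"
        by (rule has_integral_norm_le[OF dZ_Suc_has_integral])
          (use s b L in \<open>auto simp: dZ_0 intro: order_trans[OF b(1)]\<close>)
      also have "\<dots> = (L\<^sup>2 * s) * norm x" using s by (simp add: power2_eq_square)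
      also have "\<dots> \<le> C' 0 s * norm x" using C'_0 s by (intro mult_right_mono) auto
      finally show "norm (f (Z 0 x s) - dZ (Suc 0) x s (f x)) \<le> C' 0 s * norm x"
        by (simp add: norm_minus_commute)
    qed (use 0 in auto)
  next
    case (Suc j)
    show ?case
    proof (rule after)
      fix s assume s: "0 \<le> s" "s \<le> \<delta>" "s \<le> t (Suc j)"
      let ?Z = "Z (Suc j) x" and ?e = "\<lambda>\<sigma>. F j x \<sigma> - dZ (Suc j) x \<sigma> (f x)"
      have "((\<lambda>\<sigma>. f' (?Z \<sigma>) (F j x \<sigma>) - f' (?Z \<sigma>) (dZ (Suc j) x \<sigma> (f x))) has_integral
          (f (?Z s) - f x) - (dZ (Suc (Suc j)) x s (f x) - f x)) {0..s}"
        using s by (intro has_integral_diff f_Z_has_integral dZ_Suc_has_integral)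
      then have "((\<lambda>\<sigma>. f' (?Z \<sigma>) (?e \<sigma>)) has_integral
          f (?Z s) - dZ (Suc (Suc j)) x s (f x)) {0..s}"
        using linear_diff[OF has_derivative_linear[OF f_derivative]] by simp
      then have "norm (f (?Z s) - dZ (Suc (Suc j)) x s (f x))
          \<le> integral {0..s} (\<lambda>\<sigma>. L * C j \<sigma> * norm x)"
      proof (rule has_integral_norm_le)
        show "continuous_on {0..s} (\<lambda>\<sigma>. L * C j \<sigma> * norm x)"
          using s by (intro continuous_intros continuous_on_subset[OF C_cont]) auto
        fix \<sigma> assume \<sigma>: "\<sigma> \<in> {0..s}"
        then have "norm (?Z \<sigma>) < 4 * K * r" using s by (intro ball_3(1) picard_norm_le) auto
        then have "norm (f' (?Z \<sigma>) (?e \<sigma>)) \<le> L * norm (?e \<sigma>)" by (rule norm_f'_le)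
        also have "\<dots> \<le> L * (C j \<sigma> * norm x)" using Suc.IH[of \<sigma>] \<sigma> s L by (intro mult_left_mono) auto
        finally show "norm (f' (?Z \<sigma>) (?e \<sigma>)) \<le> L * C j \<sigma> * norm x" by simp
      qed
      also have "\<dots> = (L * integral {0..s} (C j)) * norm x" by simp
      also have "\<dots> \<le> C' (Suc j) s * norm x" using C'_Suc s by (intro mult_right_mono) auto
      finally show "norm (f (?Z s) - dZ (Suc (Suc j)) x s (f x)) \<le> C' (Suc j) s * norm x" .
    qed (use Suc.prems in auto)
  qed
qed

end

section \<open>The Lyapunov function of a Picard iterate\<close>

context windowed_picard begin

definition V :: "nat \<Rightarrow> real ^ 'n \<Rightarrow> real" where
  "V j y = integral {0..\<delta>} (\<lambda>s. Z j y s \<bullet> Z j y s)"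

lemma V_has_derivative:
  "(V j has_derivative (\<lambda>v. integral {0..\<delta>} (\<lambda>s. 2 * (Z j x s \<bullet> dZ j x s v)))) (at x)"
proof -
  have *: "frechet_derivative (\<lambda>y. Z j y s \<bullet> Z j y s) (at x) = (\<lambda>v. 2 * (Z j x s \<bullet> dZ j x s v))"
    if "s \<ge> 0" for s
  proof (rule frechet_derivative_at[symmetric])
    show "((\<lambda>y. Z j y s \<bullet> Z j y s) has_derivative (\<lambda>v. 2 * (Z j x s \<bullet> dZ j x s v))) (at x)"
      by (rule has_derivative_eq_rhs[OF has_derivative_inner[OF Z_has_derivative Z_has_derivative]])
        (use that in \<open>auto simp: inner_commute\<close>)
  qed
  have eq: "(\<lambda>v. integral {0..\<delta>} (\<lambda>s. frechet_derivative (\<lambda>y. Z j y s \<bullet> Z j y s) (at x) v))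
      = (\<lambda>v. integral {0..\<delta>} (\<lambda>s. 2 * (Z j x s \<bullet> dZ j x s v)))"
    by (intro ext integral_cong) (simp add: *)
  show ?thesis
    unfolding V_def[abs_def] eq[symmetric]
    by (rule poly_family_integral_has_derivative[OF poly_family_inner[OF poly_family_Z poly_family_Z]])
      (use \<delta> in simp)
qed

end

context windowed_picard_at begin

lemma norm_Z_le:
  assumes "0 \<le> s" "s \<le> \<delta>" "B j s \<le> \<epsilon>"
  shows "norm (Z j x s) \<le> (K + \<epsilon>) * norm x"
proof -
  have "norm (Z j x s) \<le> norm (Z j x s - \<phi> s) + norm (\<phi> s)"
    by (metis diff_add_cancel norm_triangle_ineq)
  also have "\<dots> \<le> B j s * norm x + K * norm x"
    using picard_error_le[of s j] \<phi>_le[of s] assms by (intro add_mono) auto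
  also have "\<dots> \<le> \<epsilon> * norm x + K * norm x"
    using assms by (intro add_mono mult_right_mono) auto
  finally show ?thesis by (simp add: algebra_simps)
qed

lemma V_upper:
  assumes "\<And>s. 0 \<le> s \<Longrightarrow> s \<le> \<delta> \<Longrightarrow> B j s \<le> \<epsilon>"
  shows "V j x \<le> \<delta> * (K + \<epsilon>)\<^sup>2 * (norm x)\<^sup>2"
proof -
  have "V j x \<le> integral {0..\<delta>} (\<lambda>_. ((K + \<epsilon>) * norm x)\<^sup>2)"
    unfolding V_def
  proof (rule integral_le)
    fix s assume "s \<in> {0..\<delta>}"
    then show "Z j x s \<bullet> Z j x s \<le> ((K + \<epsilon>) * norm x)\<^sup>2"
      using norm_Z_le assms by (auto simp: dot_square_norm intro!: power_mono)
  qed (auto intro!: integrable_continuous_real continuous_intros continuous_on_subset[OF continuous_Z])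
  also have "\<dots> = \<delta> * (K + \<epsilon>)\<^sup>2 * (norm x)\<^sup>2"
    using \<delta> by (simp add: power_mult_distrib)
  finally show ?thesis .
qed

text \<open>The iterate starts at \<open>x\<close> with speed at most
  \<open>3 * K * L * norm x\<close>, so until time \<open>1 / (6 * K * L)\<close> its norm stays
  above \<open>norm x / 2\<close>.\<close>

lemma V_lower:
  assumes "s\<^sub>0 = min \<delta> (1 / (6 * K * L))"
  shows "s\<^sub>0 / 4 * (norm x)\<^sup>2 \<le> V (Suc i) x"
proof -
  let ?Z = "Z (Suc i) x"
  have s0: "0 \<le> s\<^sub>0" "s\<^sub>0 \<le> \<delta>" using assms \<delta> K L by auto
  have int: "(\<lambda>s. ?Z s \<bullet> ?Z s) integrable_on {0..u}" for u
    by (intro integrable_continuous_real continuous_intros continuous_on_subset[OF continuous_Z]) auto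
  have "s\<^sub>0 / 4 * (norm x)\<^sup>2 = integral {0..s\<^sub>0} (\<lambda>_. (norm x / 2)\<^sup>2)"
    using s0 by (simp add: power_divide)
  also have "\<dots> \<le> integral {0..s\<^sub>0} (\<lambda>s. ?Z s \<bullet> ?Z s)"
  proof (rule integral_le)
    fix s assume s: "s \<in> {0..s\<^sub>0}"
    have "norm (?Z s - x) \<le> integral {0..s} (\<lambda>_. 3 * K * L * norm x)"
    proof (rule has_integral_norm_le[OF Z_Suc_has_integral])
      fix \<sigma> assume \<sigma>: "\<sigma> \<in> {0..s}"
      show "norm (F i x \<sigma>) \<le> 3 * K * L * norm x"
      proof (cases "\<sigma> \<le> t i")
        case True
        then have "norm (Z i x \<sigma>) \<le> 3 * K * norm x" using \<sigma> s s0 by (intro picard_norm_le) auto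
        then show ?thesis using ball_3(2) True by (simp add: F_def)
      qed (use K L in \<open>simp add: F_def\<close>)
    qed (use s in auto)
    also have "\<dots> = (3 * K * L * s) * norm x" using s by simp
    also have "\<dots> \<le> (1 / 2) * norm x"
    proof (rule mult_right_mono)
      have "s \<le> 1 / (6 * K * L)" using s assms by simp
      then have "s * (6 * K * L) \<le> 1" using K L by (simp add: pos_le_divide_eq)
      then show "3 * K * L * s \<le> 1 / 2" by (simp add: algebra_simps)
    qed simp
    finally have "norm x / 2 \<le> norm (?Z s)"
      using norm_triangle_ineq2[of x "x - ?Z s"] by (simp add: norm_minus_commute)
    then show "(norm x / 2)\<^sup>2 \<le> ?Z s \<bullet> ?Z s"
      unfolding dot_square_norm by (intro power_mono) auto
  qed (use int in auto)
  also have "\<dots> \<le> V (Suc i) x"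
    unfolding V_def using s0 by (intro integral_subset_le int) auto
  finally show ?thesis .
qed

text \<open>If \<open>dZ (Suc i) x s (f x)\<close> were the velocity \<open>F i x s\<close> of the
  iterate, the integral would be the increase of the squared norm from \<open>x\<close> to time
  \<open>\<delta>\<close>. Replacing one by the other costs at most
  \<open>2 * (K + \<epsilon>)\<close> times the integral of \<open>C i\<close>, up to the factor
  \<open>(norm x)\<^sup>2\<close>.\<close>

lemma V_decrease:
  assumes \<epsilon>: "\<And>s. 0 \<le> s \<Longrightarrow> s \<le> \<delta> \<Longrightarrow> B (Suc i) s \<le> \<epsilon>"
    and \<kappa>: "norm (\<phi> \<delta>) \<le> \<kappa> * norm x"
  shows "integral {0..\<delta>} (\<lambda>s. 2 * (Z (Suc i) x s \<bullet> dZ (Suc i) x s (f x)))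
    \<le> ((\<kappa> + \<epsilon>)\<^sup>2 + 2 * (K + \<epsilon>) * integral {0..\<delta>} (C i) - 1) * (norm x)\<^sup>2"
proof -
  let ?Z = "Z (Suc i) x" and ?g = "\<lambda>s. dZ (Suc i) x s (f x)"
  let ?I = "integral {0..\<delta>} (\<lambda>s. 2 * (?Z s \<bullet> ?g s))"
  have "((\<lambda>s. 2 * (?Z s \<bullet> F i x s)) has_integral ?Z \<delta> \<bullet> ?Z \<delta> - ?Z 0 \<bullet> ?Z 0) {0..\<delta>}"
  proof (rule fundamental_theorem_of_calculus_interior_strong[of "{t i}"])
    fix \<sigma> assume \<sigma>: "\<sigma> \<in> {0<..<\<delta>} - {t i}"
    then have "(?Z has_vector_derivative F i x \<sigma>) (at \<sigma>)"
      by (intro Z_has_vector_derivative) auto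
    then show "((\<lambda>s. ?Z s \<bullet> ?Z s) has_vector_derivative 2 * (?Z \<sigma> \<bullet> F i x \<sigma>)) (at \<sigma>)"
      unfolding has_vector_derivative_def
      by (auto intro!: derivative_eq_intros simp: inner_commute algebra_simps simp del: picard.simps)
  qed (use \<delta> in \<open>auto intro!: continuous_intros continuous_on_subset[OF continuous_Z] simp del: picard.simps\<close>)
  moreover have "?Z 0 = x" using t_nonneg[of i] by simp
  ultimately have 1: "((\<lambda>s. 2 * (?Z s \<bullet> F i x s)) has_integral ?Z \<delta> \<bullet> ?Z \<delta> - x \<bullet> x) {0..\<delta>}"
    by metis
  have 2: "((\<lambda>s. 2 * (?Z s \<bullet> ?g s)) has_integral ?I) {0..\<delta>}"
    by (intro integrable_integral integrable_continuous_real continuous_intros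
        continuous_on_subset[OF continuous_Z] continuous_on_subset[OF continuous_dZ]) auto
  have "norm (?Z \<delta> \<bullet> ?Z \<delta> - x \<bullet> x - ?I) \<le>
      integral {0..\<delta>} (\<lambda>s. 2 * (K + \<epsilon>) * (norm x)\<^sup>2 * C i s)"
  proof (rule has_integral_norm_le[OF has_integral_diff[OF 1 2]])
    show "continuous_on {0..\<delta>} (\<lambda>s. 2 * (K + \<epsilon>) * (norm x)\<^sup>2 * C i s)"
      by (intro continuous_intros C_cont)
    fix s assume s: "s \<in> {0..\<delta>}"
    have "norm (2 * (?Z s \<bullet> F i x s) - 2 * (?Z s \<bullet> ?g s)) = 2 * \<bar>?Z s \<bullet> (F i x s - ?g s)\<bar>"
      by (simp add: inner_diff_right abs_if del: picard.simps)
    also have "\<dots> \<le> 2 * (norm (?Z s) * norm (F i x s - ?g s))"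
      using Cauchy_Schwarz_ineq2 by (intro mult_left_mono) auto
    also have "\<dots> \<le> 2 * (((K + \<epsilon>) * norm x) * (C i s * norm x))"
    proof (intro mult_left_mono mult_mono')
      show "norm (?Z s) \<le> (K + \<epsilon>) * norm x" using s \<epsilon> by (intro norm_Z_le) auto
      show "norm (F i x s - ?g s) \<le> C i s * norm x" using s by (intro derivative_error_le) auto
    qed auto
    finally show "norm (2 * (?Z s \<bullet> F i x s) - 2 * (?Z s \<bullet> ?g s)) \<le> 2 * (K + \<epsilon>) * (norm x)\<^sup>2 * C i s"
      by (simp add: power2_eq_square mult_ac del: picard.simps)
  qed
  also have "\<dots> = 2 * (K + \<epsilon>) * integral {0..\<delta>} (C i) * (norm x)\<^sup>2" by simp
  finally have 3: "?I \<le> ?Z \<delta> \<bullet> ?Z \<delta> - x \<bullet> x + 2 * (K + \<epsilon>) * integral {0..\<delta>} (C i) * (norm x)\<^sup>2"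
    unfolding real_norm_def by linarith
  have "norm (?Z \<delta>) \<le> norm (?Z \<delta> - \<phi> \<delta>) + norm (\<phi> \<delta>)"
    by (metis diff_add_cancel norm_triangle_ineq)
  also have "\<dots> \<le> \<epsilon> * norm x + \<kappa> * norm x"
    using picard_error_le[of \<delta> "Suc i"] mult_right_mono[OF \<epsilon>[of \<delta>], of "norm x"] \<delta> \<kappa>
    by (intro add_mono) auto
  finally have "norm (?Z \<delta>) \<le> (\<kappa> + \<epsilon>) * norm x" by (simp add: algebra_simps)
  then have "(norm (?Z \<delta>))\<^sup>2 \<le> ((\<kappa> + \<epsilon>) * norm x)\<^sup>2" by (intro power_mono) auto
  then have "?Z \<delta> \<bullet> ?Z \<delta> \<le> (\<kappa> + \<epsilon>)\<^sup>2 * (norm x)\<^sup>2"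
    unfolding dot_square_norm by (simp add: power_mult_distrib)
  with 3 show ?thesis unfolding dot_square_norm[of x] by (simp add: algebra_simps del: picard.simps)
qed

end

text \<open>\<open>P\<close> and the three constants are the same for all of \<open>M\<close>; only
  the trajectory used for the estimates, and with it the instance of
  \<open>windowed_picard_at\<close>, varies with \<open>x\<close>.\<close>

lemma (in windowed_picard) exists_certificate:
  assumes e: "bij_betw e {..<D} (exponents (q ^ Suc i))"
    and M: "M \<subseteq> cball 0 r"
    and trajectory: "\<And>x. x \<in> M \<Longrightarrow> \<exists>\<phi>. (\<forall>s\<ge>0. ((\<lambda>\<sigma>. f (\<phi> \<sigma>)) has_integral \<phi> s - x) {0..s} \<and>
        norm (\<phi> s) \<le> K * norm x) \<and> norm (\<phi> \<delta>) \<le> \<kappa> * norm x"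
    and \<epsilon>: "\<And>s. 0 \<le> s \<Longrightarrow> s \<le> \<delta> \<Longrightarrow> B (Suc i) s \<le> \<epsilon>" "\<epsilon> \<ge> 0"
    and small: "(\<kappa> + \<epsilon>)\<^sup>2 + 2 * (K + \<epsilon>) * integral {0..\<delta>} (C i) < 1"
  shows "\<exists>\<alpha>>0. \<exists>\<beta>>0. \<exists>\<gamma>>0. \<exists>P\<in>carrier_mat D D.
           transpose_mat P = P \<and> psd_mat D P \<and>
           (\<forall>x\<in>M. \<alpha> * (norm x)\<^sup>2 \<le> quadratic_form P (monomial_vec D e x) \<and>
                  quadratic_form P (monomial_vec D e x) \<le> \<beta> * (norm x)\<^sup>2) \<and>
           (\<forall>x\<in>M. \<exists>g. GDERIV (\<lambda>y. quadratic_form P (monomial_vec D e y)) x :> g \<and>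
                  g \<bullet> f x \<le> - \<gamma> * (norm x)\<^sup>2)"
proof -
  have traj: "\<exists>\<phi>. windowed_picard_at f f' c q L K r \<delta> t B C C' x \<phi> \<and> norm (\<phi> \<delta>) \<le> \<kappa> * norm x"
    if x: "x \<in> M" for x
  proof -
    obtain \<phi> where \<phi>: "\<And>s. s \<ge> 0 \<Longrightarrow> ((\<lambda>\<sigma>. f (\<phi> \<sigma>)) has_integral \<phi> s - x) {0..s}"
      "\<And>s. s \<ge> 0 \<Longrightarrow> norm (\<phi> s) \<le> K * norm x" "norm (\<phi> \<delta>) \<le> \<kappa> * norm x"
      using trajectory[OF x] by blast
    have "windowed_picard_at f f' c q L K r \<delta> t B C C' x \<phi>"
      by unfold_locales (use \<phi> M x in auto)
    with \<phi>(3) show ?thesis by blast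
  qed
  obtain P where P: "P \<in> carrier_mat D D" "transpose_mat P = P" "psd_mat D P"
    "\<And>x. quadratic_form P (monomial_vec D e x) = V (Suc i) x"
    using poly_family_gram_matrix[OF poly_family_Z e, where t = \<delta>] unfolding V_def by blast
  define \<alpha> where "\<alpha> = min \<delta> (1 / (6 * K * L)) / 4"
  define \<beta> where "\<beta> = \<delta> * (K + \<epsilon>)\<^sup>2"
  define \<gamma> where "\<gamma> = 1 - ((\<kappa> + \<epsilon>)\<^sup>2 + 2 * (K + \<epsilon>) * integral {0..\<delta>} (C i))"
  have pos: "\<alpha> > 0" "\<beta> > 0" "\<gamma> > 0"
    using \<delta> K L \<epsilon>(2) small by (auto simp: \<alpha>_def \<beta>_def \<gamma>_def)
  have bounds: "\<alpha> * (norm x)\<^sup>2 \<le> V (Suc i) x \<and> V (Suc i) x \<le> \<beta> * (norm x)\<^sup>2"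
    if x: "x \<in> M" for x
  proof -
    obtain \<phi> where at: "windowed_picard_at f f' c q L K r \<delta> t B C C' x \<phi>"
      using traj[OF x] by blast
    interpret windowed_picard_at f f' c q L K r \<delta> t B C C' x \<phi> by (fact at)
    show ?thesis
      unfolding \<alpha>_def \<beta>_def using V_lower[OF refl, of i] V_upper[of "Suc i" \<epsilon>] \<epsilon>(1) by simp
  qed
  have gradient: "\<exists>g. GDERIV (V (Suc i)) x :> g \<and> g \<bullet> f x \<le> - \<gamma> * (norm x)\<^sup>2"
    if x: "x \<in> M" for x
  proof -
    obtain \<phi> where at: "windowed_picard_at f f' c q L K r \<delta> t B C C' x \<phi>"
        "norm (\<phi> \<delta>) \<le> \<kappa> * norm x"
      using traj[OF x] by blast
    interpret windowed_picard_at f f' c q L K r \<delta> t B C C' x \<phi> by (fact at(1))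
    let ?D = "\<lambda>v. integral {0..\<delta>} (\<lambda>s. 2 * (Z (Suc i) x s \<bullet> dZ (Suc i) x s v))"
    have D: "(V (Suc i) has_derivative ?D) (at x)" by (rule V_has_derivative)
    \<comment> \<open>The gradient: the adjoint of a functional, applied to \<open>1\<close>,
      represents it through the inner product.\<close>
    define g where "g = adjoint ?D 1"
    have g: "v \<bullet> g = ?D v" for v
      unfolding g_def by (subst adjoint_works[OF has_derivative_linear[OF D]]) simp
    have "GDERIV (V (Suc i)) x :> g"
      unfolding gderiv_def using D by (rule has_derivative_eq_rhs) (simp add: g)
    moreover have "g \<bullet> f x \<le> - \<gamma> * (norm x)\<^sup>2"
      unfolding inner_commute[of g] g \<gamma>_def using V_decrease[OF \<epsilon>(1) at(2)] by (simp add: algebra_simps)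
    ultimately show ?thesis by blast
  qed
  show ?thesis
    by (intro exI[of _ \<alpha>] exI[of _ \<beta>] exI[of _ \<gamma>] conjI bexI[of _ P] pos P(1-3) ballI)
      (use bounds gradient in \<open>auto simp: P(4)\<close>)
qed

section \<open>Numerical consequences of the degree bound\<close>

lemma fact_add_ge: "fact m * real m ^ n \<le> fact (m + n)"
proof (induction n)
  case (Suc n)
  have "fact m * real m ^ Suc n = real m * (fact m * real m ^ n)" by simp
  also have "\<dots> \<le> (real m + real n + 1) * fact (m + n)"
    using Suc by (intro mult_mono) auto
  also have "\<dots> = fact (m + Suc n)" by (simp add: algebra_simps)
  finally show ?case .
qed simp

text \<open>For \<open>\<rho> \<le> 2\<close> this bounds the error
  \<open>\<rho> ^ (N * k) / fact (N * k)\<close> of one long iteration by a third of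
  \<open>N * (\<rho> / N) ^ k\<close>, the quantity controlled by the degree bound. Equality holds
  at \<open>N = k = 2\<close>. Raising \<open>k\<close> by one multiplies the left side by at most
  \<open>(N * k) ^ N\<close> and the factorial by at least that.\<close>

lemma fact_mult_ge:
  assumes "N \<ge> 2" "k \<ge> 2"
  shows "3 * (2 ^ ((N - 1) * k) * real N ^ (k - 1)) \<le> fact (N * k)"
  using assms(2)
proof (induction k rule: dec_induct)
  case base
  have four: "2 ^ (i * 2) = (4::real) ^ i" for i
    by (simp add: mult.commute[of i] power_mult)
  show ?case using assms(1)
  proof (induction N rule: dec_induct)
    case base
    show ?case by (simp add: fact_numeral)
  next
    case (step N)
    then obtain M where M: "N = Suc M" by (cases N) auto
    have "3 * (2 ^ ((Suc N - 1) * 2) * real (Suc N) ^ (2 - 1)) = 3 * 4 ^ M * (4 * (real N + 1))"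
      by (simp add: M four algebra_simps)
    also have "\<dots> \<le> 3 * 4 ^ M * (real N * ((2 * real N + 1) * (2 * real N + 2)))"
    proof (intro mult_left_mono)
      have "4 \<le> real N * (2 * real N + 1) * 2" using step(1) M by (simp add: algebra_simps)
      from mult_right_mono[OF this, of "real N + 1"]
      show "4 * (real N + 1) \<le> real N * ((2 * real N + 1) * (2 * real N + 2))"
        by (simp add: algebra_simps)
    qed auto
    also have "\<dots> = (3 * (2 ^ ((N - 1) * 2) * real N ^ (2 - 1))) * ((2 * real N + 1) * (2 * real N + 2))"
      by (simp add: M four algebra_simps)
    also have "\<dots> \<le> fact (N * 2) * ((2 * real N + 1) * (2 * real N + 2))"
      using step(3) by (intro mult_right_mono) auto
    also have "\<dots> = fact (Suc N * 2)" by (simp add: algebra_simps)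
    finally show ?case .
  qed
next
  case (step k)
  have "real N * 2 ^ (N - 1) \<le> real N ^ N"
  proof -
    have "2 ^ (N - 1) \<le> real N ^ (N - 1)" using assms(1) by (intro power_mono) auto
    then have "real N * 2 ^ (N - 1) \<le> real N * real N ^ (N - 1)" by (intro mult_left_mono) auto
    also have "\<dots> = real N ^ N" using assms(1) by (simp flip: power_Suc)
    finally show ?thesis .
  qed
  also have "\<dots> \<le> real (N * k) ^ N"
  proof (intro power_mono)
    have "real N * 1 \<le> real N * real k" using step(1) by (intro mult_left_mono) auto
    then show "real N \<le> real (N * k)" by simp
  qed simp
  finally have 1: "real N * 2 ^ (N - 1) \<le> real (N * k) ^ N" .
  have "3 * (2 ^ ((N - 1) * Suc k) * real N ^ (Suc k - 1))
      = (3 * (2 ^ ((N - 1) * k) * real N ^ (k - 1))) * (real N * 2 ^ (N - 1))"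
    using step(1) by (cases k) (auto simp: power_add)
  also have "\<dots> \<le> fact (N * k) * real (N * k) ^ N"
    using step(3) 1 by (intro mult_mono) auto
  also have "\<dots> \<le> fact (N * k + N)" by (rule fact_add_ge)
  also have "\<dots> = fact (N * Suc k)" by (simp add: algebra_simps)
  finally show ?case .
qed

text \<open>The estimates have little room to spare only for \<open>N = 1\<close>, \<open>k = 2\<close>.\<close>

lemma short_time_error:
  fixes K \<rho> :: real and N k :: nat
  defines "x \<equiv> K\<^sup>2 * (\<rho> / N) ^ k * N"
  assumes K: "K \<ge> 1" and \<rho>: "\<rho> \<ge> 1/3" "\<rho> \<le> 2" and N: "N \<ge> 1" "\<rho> / N < 1 / 2" and k: "k \<ge> 1"
    and x: "x\<^sup>2 + x * (1 + x) * (1 + x / K) < 1 / 2"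
    and y: "y = K * (\<rho> ^ (N * k) / fact (N * k))" and \<tau>: "\<tau> = \<rho> ^ (N * k) / fact (N * k)"
  shows "k \<ge> 2" "(1 / sqrt 2 + y)\<^sup>2 + 2 * (K + y) * \<tau> < 1"
proof -
  have x0: "x \<ge> 0" using K \<rho> by (simp add: x_def)
  have "x * (1 + x) * 1 \<le> x * (1 + x) * (1 + x / K)"
    using x0 K by (intro mult_left_mono) auto
  then have x': "x\<^sup>2 + x * (1 + x) < 1 / 2" using x by linarith
  \<comment> \<open>The positive root of \<open>2 * x\<^sup>2 + x = 1 / 2\<close> is
    \<open>(sqrt 5 - 1) / 4\<close>, about 0.309.\<close>
  have x31: "x < (31 / 100)"
  proof (rule ccontr)
    assume "\<not> x < (31 / 100)"
    then have "(31 / 100) * (31 / 100) \<le> x * x" "(31 / 100) \<le> x" using mult_mono[of "31/100" x "31/100" x] by auto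
    then show False using x' by (simp add: power2_eq_square algebra_simps)
  qed
  have "k \<noteq> 1"
  proof
    assume "k = 1"
    then have "x = K\<^sup>2 * \<rho>" using N by (simp add: x_def)
    moreover have "1 * (1/3) \<le> K\<^sup>2 * \<rho>" using K \<rho> by (intro mult_mono) auto
    ultimately show False using x31 by simp
  qed
  then show k2: "k \<ge> 2" using k by simp
  have \<tau>0: "\<tau> \<ge> 0" using \<tau> \<rho> by simp
  have y\<tau>: "y = K * \<tau>" "y \<ge> \<tau>" using \<tau>0 \<tau> y K mult_right_mono[of 1 K \<tau>] by auto
  \<comment> \<open>Since \<open>y = K * \<tau>\<close>, the claim reads
    \<open>sqrt 2 * y + y\<^sup>2 + 2 * y + 2 * y * \<tau> < 1 / 2\<close>; the fraction 1.4143
    bounds \<open>sqrt 2\<close> from above.\<close>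
  have goal: "(1 / sqrt 2 + y)\<^sup>2 + 2 * (K + y) * \<tau> < 1"
    if a: "y \<le> a" "\<tau> \<le> b" "(14143 / 10000) * a + a\<^sup>2 + 2 * a + 2 * a * b < 1 / 2" "a \<ge> 0" "b \<ge> 0" for a b
  proof -
    have "sqrt 2 \<le> (14143 / 10000)" by (rule real_le_lsqrt) (auto simp: power2_eq_square)
    then have "sqrt 2 * y \<le> (14143 / 10000) * a" using a y\<tau> \<tau>0 by (intro mult_mono) auto
    moreover have "y\<^sup>2 \<le> a\<^sup>2" using a y\<tau> \<tau>0 by (intro power_mono) auto
    moreover have "2 * y * \<tau> \<le> 2 * a * b" using a y\<tau> \<tau>0 by (intro mult_mono) auto
    moreover have "(1 / sqrt 2 + y)\<^sup>2 = 1 / 2 + sqrt 2 * y + y\<^sup>2"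
      by (simp add: power2_sum power_divide real_div_sqrt)
    moreover have "2 * (K + y) * \<tau> = 2 * y + 2 * y * \<tau>" using y\<tau> by (simp add: algebra_simps)
    ultimately show ?thesis using a by linarith
  qed
  have KK: "K \<le> K\<^sup>2" using K by (simp add: power2_eq_square mult_le_cancel_right1)
  show "(1 / sqrt 2 + y)\<^sup>2 + 2 * (K + y) * \<tau> < 1"
  proof (cases "N = 1")
    case True
    have \<rho>2: "\<rho> < 1 / 2" using N True by simp
    have xr: "x = K\<^sup>2 * \<rho> ^ k" using True by (simp add: x_def)
    show ?thesis
    proof (cases "k = 2")
      case k: True
      have \<tau>': "\<tau> = \<rho>\<^sup>2 / 2" using \<tau> True k by (simp add: fact_numeral)
      have "\<rho>\<^sup>2 \<le> (1 / 2)\<^sup>2" using \<rho> \<rho>2 by (intro power_mono) auto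
      then have \<tau>8: "\<tau> \<le> 1 / 8" using \<tau>' by (simp add: power2_eq_square)
      \<comment> \<open>With \<open>\<tau> \<le> 1 / 8\<close>, \<open>goal\<close> tolerates hardly
        more than 0.1316. A larger \<open>y\<close> forces \<open>K \<ge> 1.0528\<close>, hence a
        larger \<open>x = 2 * K * y\<close>, and then the hypothesis on \<open>x\<close> fails:
        0.446 + 0.076 exceeds one half.\<close>
      have "y < (1316 / 10000)"
      proof (rule ccontr)
        assume "\<not> y < (1316 / 10000)"
        then have y13: "y \<ge> (1316 / 10000)" by simp
        have "y \<le> K * (1 / 8)" using y\<tau> \<tau>8 K by simp
        then have K1: "K \<ge> (10528 / 10000)" using y13 by simp
        have xy: "x = 2 * K * y" using xr k \<tau>' y\<tau> by (simp add: power2_eq_square)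
        have "2 * ((10528 / 10000) * (1316 / 10000)) \<le> 2 * (K * y)" using K1 y13 by (intro mult_left_mono mult_mono) auto
        then have x27: "x \<ge> (277 / 1000)" using xy by simp
        have "x / K \<ge> (263 / 1000)" using xy y13 K by simp
        then have "(277 / 1000) * (1 + 277 / 1000) * (1 + 263 / 1000) \<le> x * (1 + x) * (1 + x / K)"
          using x27 by (intro mult_mono) auto
        then have "446 / 1000 \<le> x * (1 + x) * (1 + x / K)" by (rule order_trans[rotated]) simp
        moreover have "(277 / 1000)\<^sup>2 \<le> x\<^sup>2" using x27 by (intro power_mono) auto
        then have "76 / 1000 \<le> x\<^sup>2" by (rule order_trans[rotated]) (simp add: power2_eq_square)
        ultimately show False using x by linarith
      qed
      then show ?thesis using \<tau>8 by (intro goal[of "(1316 / 10000)" "1/8"]) (auto simp: power2_eq_square)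
    next
      case False
      then have "k \<ge> 3" using k2 by simp
      then have "fact k \<ge> (fact 3 :: real)" by (intro fact_mono)
      then have "\<rho> ^ k / fact k \<le> \<rho> ^ k / 6" using \<rho> by (intro divide_left_mono) (auto simp: fact_numeral)
      then have "\<tau> \<le> \<rho> ^ k / 6" using \<tau> True by simp
      then have "K\<^sup>2 * \<tau> \<le> K\<^sup>2 * (\<rho> ^ k / 6)" by (intro mult_left_mono) auto
      also have "\<dots> = x / 6" using xr by simp
      finally have "K\<^sup>2 * \<tau> \<le> x / 6" .
      moreover have "y \<le> K\<^sup>2 * \<tau>" using KK \<tau>0 y\<tau> by (auto intro: mult_right_mono)
      \<comment> \<open>Here \<open>y \<le> x / 6\<close>, and 0.31 / 6 is below 0.052.\<close>
      ultimately have "y \<le> (52 / 1000)" using x31 by simp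
      then show ?thesis using y\<tau> by (intro goal[of "(52 / 1000)" "(52 / 1000)"]) (auto simp: power2_eq_square)
    qed
  next
    case False
    then have N2: "N \<ge> 2" using N by simp
    then obtain M where M: "N = Suc M" by (cases N) auto
    obtain l where l: "k = Suc l" using k by (cases k) auto
    \<comment> \<open>Of the \<open>N\<close> factors \<open>\<rho> ^ k\<close> all but one are
      estimated by \<open>2 ^ k\<close>; \<open>fact_mult_ge\<close> cancels them and leaves
      \<open>y \<le> x / 3\<close>, where 0.31 / 3 is below 0.104.\<close>
    have "\<rho> ^ (N * k) = \<rho> ^ (M * k) * \<rho> ^ k" by (simp add: M power_add)
    also have "\<dots> \<le> 2 ^ (M * k) * \<rho> ^ k" using \<rho> by (intro mult_right_mono power_mono) auto
    finally have 1: "\<rho> ^ (N * k) \<le> 2 ^ (M * k) * \<rho> ^ k" .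
    have 2: "3 * (2 ^ (M * k) * real N ^ l) \<le> fact (N * k)"
      using fact_mult_ge[OF N2 k2] by (simp add: M l)
    have "\<tau> \<le> (2 ^ (M * k) * \<rho> ^ k) / (3 * (2 ^ (M * k) * real N ^ l))"
      unfolding \<tau> using 1 2 \<rho> N by (intro frac_le) auto
    also have "\<dots> = \<rho> ^ k / real N ^ l / 3" by simp
    also have "\<dots> = (\<rho> / N) ^ k * N / 3" using N by (simp add: l power_divide)
    finally have "K\<^sup>2 * \<tau> \<le> K\<^sup>2 * ((\<rho> / N) ^ k * N / 3)" by (intro mult_left_mono) auto
    also have "\<dots> = x / 3" by (simp add: x_def)
    finally have "K\<^sup>2 * \<tau> \<le> x / 3" .
    moreover have "y \<le> K\<^sup>2 * \<tau>" using KK \<tau>0 y\<tau> by (auto intro: mult_right_mono)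
    ultimately have "y \<le> (104 / 1000)" using x31 by simp
    then show ?thesis using y\<tau> by (intro goal[of "(104 / 1000)" "(104 / 1000)"]) (auto simp: power2_eq_square)
  qed
qed

lemma exp_half_le: "exp (1 / 2 :: real) \<le> 165 / 100"
proof -
  have "exp (1 / 2 :: real) ^ 2 = exp 1" by (simp flip: exp_of_nat_mult)
  also have "\<dots> \<le> (165 / 100) ^ 2" using e_less_272 by (simp add: power2_eq_square)
  finally show ?thesis by (rule power2_le_imp_le) simp
qed

text \<open>With \<open>\<alpha> = \<rho> / N\<close>, the geometric sum is about
  \<open>exp \<rho>\<close>, so \<open>K\<^sup>2 * \<alpha> ^ k * exp \<rho>\<close> is below 1.
  Logarithms bound \<open>k * - ln \<alpha>\<close> from below, and
  \<open>- ln \<alpha> \<le> 1 / (exp 1 * \<alpha>)\<close> converts this into a bound on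
  \<open>N * k\<close> with the factor \<open>exp 1\<close>, which exceeds 2.7.\<close>

lemma long_time_iterations:
  fixes K \<rho> c :: real and N k :: nat
  assumes K: "K \<ge> 1" and \<rho>: "\<rho> \<ge> 2" and N: "N \<ge> 1" "\<rho> / N < 1 / 2"
    and c: "K\<^sup>2 * (\<rho> / N) ^ k * (\<Sum>i<N. exp (\<rho> / N) ^ i) \<le> c" "c\<^sup>2 < 1 / 2"
  shows "real (N * k) \<ge> (27 / 10) * \<rho> * (\<rho> + 2 * ln K + (6 / 10))"
proof -
  define \<alpha> where "\<alpha> = \<rho> / N"
  have \<alpha>: "\<alpha> > 0" "\<alpha> < 1 / 2" "N * \<alpha> = \<rho>" using \<rho> N by (auto simp: \<alpha>_def)
  have c7: "c < (71 / 100)"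
  proof (rule ccontr)
    assume "\<not> c < (71 / 100)"
    then have "(71 / 100) ^ 2 \<le> c ^ 2" by (intro power_mono) auto
    then show False using c by (simp add: power2_eq_square)
  qed
  have "exp \<alpha> - 1 \<le> (65 / 100)" using exp_half_le exp_less_cancel_iff[of \<alpha> "1/2"] \<alpha> by linarith
  have "exp \<alpha> > 1" using \<alpha> by simp
  have geo: "(exp \<alpha> - 1) * (\<Sum>i<N. exp \<alpha> ^ i) = exp \<rho> - 1"
    using power_diff_1_eq[of "exp \<alpha>" N] \<alpha> by (simp flip: exp_of_nat_mult)
  have "K\<^sup>2 * \<alpha> ^ k * (exp \<rho> - 1) = (exp \<alpha> - 1) * (K\<^sup>2 * \<alpha> ^ k * (\<Sum>i<N. exp \<alpha> ^ i))"
    unfolding geo[symmetric] by simp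
  also have "\<dots> \<le> (65 / 100) * (71 / 100)"
    using c c7 \<alpha> \<open>exp \<alpha> - 1 \<le> (65 / 100)\<close> \<open>exp \<alpha> > 1\<close>
    by (intro mult_mono) (auto simp: \<alpha>_def intro!: mult_nonneg_nonneg sum_nonneg)
  finally have 1: "K\<^sup>2 * \<alpha> ^ k * (exp \<rho> - 1) \<le> (4615 / 10000)" by simp
  have "exp \<rho> \<ge> exp 2" using \<rho> by simp
  moreover have "exp (2::real) = exp 1 ^ 2" by (simp flip: exp_of_nat_mult)
  moreover have "exp 1 ^ 2 \<ge> ((27 / 10)::real) ^ 2" using e_approx_32 by (intro power_mono) (auto simp: abs_if split: if_splits)
  ultimately have "exp \<rho> \<ge> (72 / 10)" by (simp add: power2_eq_square)
  \<comment> \<open>The constants: 1 - 1 / 7.2 exceeds 0.86, the quotient 0.4615 / 0.86 is below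
    0.54, and \<open>ln (54 / 100) \<le> - 0.6\<close> supplies the summand 0.6 of the
    claim.\<close>
  then have "(86 / 100) * exp \<rho> \<le> exp \<rho> - 1" by simp
  then have "K\<^sup>2 * \<alpha> ^ k * ((86 / 100) * exp \<rho>) \<le> K\<^sup>2 * \<alpha> ^ k * (exp \<rho> - 1)"
    using \<alpha> by (intro mult_left_mono) auto
  with 1 have "K\<^sup>2 * \<alpha> ^ k * exp \<rho> \<le> (54 / 100)" by simp
  then have "ln (K\<^sup>2 * \<alpha> ^ k * exp \<rho>) \<le> ln (54 / 100)" using K \<alpha> by (intro ln_mono) auto
  moreover have "ln (K\<^sup>2 * \<alpha> ^ k * exp \<rho>) = 2 * ln K + k * ln \<alpha> + \<rho>"
    using K \<alpha> by (simp add: ln_mult ln_realpow)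
  moreover have "ln ((54 / 100) :: real) \<le> - (6 / 10)"
  proof -
    have "exp (1/2 + (1 / 10)) = exp (1/2) * exp ((1 / 10) :: real)" by (simp only: exp_add)
    also have "\<dots> \<le> (165 / 100) * (111 / 100)"
      using exp_half_le exp_bound_half[of "(1 / 10)::real"] exp_bound[of "(1 / 10) :: real"]
      by (intro mult_mono) (auto simp: power2_eq_square)
    finally have "exp ((6 / 10) :: real) \<le> 1 / (54 / 100)" by simp
    then have "ln (exp ((6 / 10) :: real)) \<le> ln (1 / (54 / 100))" by (intro ln_mono) auto
    then show ?thesis by (simp add: ln_div)
  qed
  ultimately have Y: "\<rho> + 2 * ln K + (6 / 10) \<le> k * - ln \<alpha>" by simp
  have e: "exp 1 \<ge> ((27 / 10) :: real)" using e_approx_32 by (auto simp: abs_if split: if_splits)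
  \<comment> \<open>The tangent of \<open>ln\<close> at 1, used at
    \<open>1 / (exp 1 * \<alpha>)\<close>, is what bounds \<open>- \<alpha> * ln \<alpha>\<close> by
    \<open>1 / exp 1\<close>.\<close>
  have "ln (1 / (exp 1 * \<alpha>)) \<le> 1 / (exp 1 * \<alpha>) - 1" using \<alpha> by (intro ln_le_minus_one) auto
  then have "- ln \<alpha> \<le> 1 / (exp 1 * \<alpha>)" using \<alpha> by (simp add: ln_div ln_mult)
  then have "- ln \<alpha> * (exp 1 * \<alpha>) \<le> 1" using \<alpha> by (simp add: pos_le_divide_eq)
  then have 2: "exp 1 * \<alpha> * - ln \<alpha> \<le> 1" by (simp add: algebra_simps)
  have "ln K \<ge> 0" using K by simp
  have "(27 / 10) * \<rho> * (\<rho> + 2 * ln K + (6 / 10)) \<le> exp 1 * \<rho> * (k * - ln \<alpha>)"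
    using Y e \<rho> \<open>ln K \<ge> 0\<close> by (intro mult_mono) auto
  also have "\<dots> = N * k * (exp 1 * \<alpha> * - ln \<alpha>)" using \<alpha> by (simp add: algebra_simps)
  also have "\<dots> \<le> real (N * k) * 1" using 2 by (intro mult_left_mono) auto
  finally show ?thesis by simp
qed

text \<open>Both error terms are governed by
  \<open>Q = K\<^sup>2 * (2 / 5) ^ m * exp (3 * \<rho>)\<close>. As \<open>m\<close> grows like
  \<open>\<rho> * (\<rho> + 2 * ln K)\<close>, the factor \<open>(2 / 5) ^ m\<close> beats both
  \<open>exp (3 * \<rho>)\<close> and \<open>K\<^sup>2\<close>, and
  \<open>Q \<le> exp (- 6)\<close>.\<close>

lemma long_time_error:
  fixes K \<rho> :: real and m :: nat
  assumes K: "K \<ge> 1" and \<rho>: "\<rho> \<ge> 2" and m: "real m \<ge> (27 / 10) * \<rho> * (\<rho> + 2 * ln K + (6 / 10))"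
    and \<epsilon>: "\<epsilon> = K * exp (3 * \<rho>) / 3 ^ m"
  shows "m \<ge> 2" "(1 / sqrt 2 + \<epsilon>)\<^sup>2 + 25 * K * (K + \<epsilon>) * (2 / 5) ^ m * exp (3 * \<rho>) < 1"
proof -
  define l where "l = ln K"
  have l: "l \<ge> 0" using K by (simp add: l_def)
  have "(27 / 10) * \<rho> * (26 / 10) \<le> (27 / 10) * \<rho> * (\<rho> + 2 * ln K + (6 / 10))"
    using \<rho> l by (intro mult_left_mono) (auto simp: l_def)
  then have m7: "real m \<ge> 7 * \<rho>" using m \<rho> by linarith
  then show m2: "m \<ge> 2" using \<rho> by linarith
  define Q where "Q = K\<^sup>2 * ((2 / 5) ^ m * exp (3 * \<rho>))"
  have Q0: "Q > 0" using K by (simp add: Q_def)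
  have ln25: "ln (2 / 5 :: real) \<le> - (9 / 10)"
  proof -
    have "exp ((9 / 10) :: real) = exp 1 * exp (- (1 / 10))" by (simp flip: exp_add)
    also have "\<dots> \<le> (272 / 100) * (1 / (11 / 10))"
    proof (intro mult_mono)
      show "exp (- (1 / 10) :: real) \<le> 1 / (11 / 10)"
        using exp_ge_add_one_self[of "(1 / 10) :: real"] by (simp add: exp_minus field_simps)
    qed (use e_less_272 in auto)
    also have "\<dots> \<le> 5 / 2" by simp
    finally have "ln (exp ((9 / 10) :: real)) \<le> ln (5 / 2)" by (intro ln_mono) auto
    then show ?thesis by (simp add: ln_div)
  qed
  have "ln Q = 2 * l + real m * ln (2 / 5) + 3 * \<rho>"
    using K by (simp add: Q_def l_def ln_mult ln_realpow)
  also have "\<dots> \<le> 2 * l + real m * (- (9 / 10)) + 3 * \<rho>"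
    using ln25 by (intro add_mono mult_left_mono) auto
  also have "\<dots> \<le> 2 * l - (9 / 10) * ((27 / 10) * \<rho> * (\<rho> + 2 * l + (6 / 10))) + 3 * \<rho>"
    using m by (simp add: l_def)
  \<comment> \<open>From \<open>\<rho> \<ge> 2\<close> follows
    \<open>\<rho> * (\<rho> + 2 * l + 0.6) \<ge> 2.6 * \<rho> + 4 * l\<close>. The product of 0.9,
    2.7 and 2.6 exceeds 6, which absorbs \<open>3 * \<rho>\<close> and leaves
    \<open>- 3 * \<rho>\<close>.\<close>
  also have "\<dots> \<le> 2 * l - (9 / 10) * ((27 / 10) * \<rho> * (26 / 10)) - (9 / 10) * ((27 / 10) * 2 * (2 * l)) + 3 * \<rho>"
  proof -
    have "\<rho> * 2 \<le> \<rho> * \<rho>" "2 * l \<le> \<rho> * l" using \<rho> l by (auto intro: mult_mono)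
    moreover have "\<rho> * (\<rho> + 2 * l + 6 / 10) = \<rho> * \<rho> + 2 * (\<rho> * l) + 6 / 10 * \<rho>"
      by (simp add: algebra_simps)
    ultimately show ?thesis by linarith
  qed
  also have "\<dots> \<le> - (3 * \<rho>)" using l \<rho> by simp
  also have "\<dots> \<le> - 6" using \<rho> by simp
  finally have "exp (ln Q) \<le> exp (- 6)" by (simp only: exp_le_cancel_iff)
  then have "Q \<le> exp (- 6)" using Q0 by simp
  moreover have "exp (6 :: real) \<ge> 60"
  proof -
    have "exp (6 :: real) = exp 1 ^ 6" by (simp flip: exp_of_nat_mult)
    moreover have "exp 1 ^ 6 \<ge> (2 :: real) ^ 6"
      using exp_ge_add_one_self[of "1::real"] by (intro power_mono) auto
    ultimately show ?thesis by simp
  qed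
  ultimately have Q: "Q \<le> 1 / 60"
    using le_imp_inverse_le[of "60::real" "exp 6"] by (simp add: exp_minus)
  have KK: "K \<le> K\<^sup>2" using K by (simp add: power2_eq_square mult_le_cancel_right1)
  have "\<epsilon> = K * ((1 / 3) ^ m * exp (3 * \<rho>))" by (simp add: \<epsilon> power_divide)
  also have "\<dots> \<le> Q" unfolding Q_def using KK
    by (intro mult_mono power_mono) auto
  finally have \<epsilon>Q: "\<epsilon> \<le> Q" .
  have \<epsilon>0: "\<epsilon> \<ge> 0" using K \<epsilon> by simp
  have "sqrt 2 \<le> (14143 / 10000)" by (rule real_le_lsqrt) (auto simp: power2_eq_square)
  then have a: "sqrt 2 * \<epsilon> \<le> (14143 / 10000) * (1 / 60)" using \<epsilon>0 \<epsilon>Q Q by (intro mult_mono) auto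
  have b: "\<epsilon>\<^sup>2 \<le> (1 / 60)\<^sup>2" using \<epsilon>0 \<epsilon>Q Q by (intro power_mono) auto
  have sq: "(1 / sqrt 2 + \<epsilon>)\<^sup>2 = 1 / 2 + sqrt 2 * \<epsilon> + \<epsilon>\<^sup>2"
    by (simp add: power2_sum power_divide real_div_sqrt)
  have "K * (K + \<epsilon>) \<le> K * (K + K * (1 / 60))"
  proof -
    have "1 / 60 \<le> K * (1 / 60)" using K by simp
    then show ?thesis using \<epsilon>Q Q K by (intro mult_left_mono) auto
  qed
  then have "K * (K + \<epsilon>) * ((2 / 5) ^ m * exp (3 * \<rho>)) \<le>
      (K * (K + K * (1 / 60))) * ((2 / 5) ^ m * exp (3 * \<rho>))"
    by (intro mult_right_mono) auto
  also have "\<dots> = 61 / 60 * Q" by (simp add: Q_def power2_eq_square algebra_simps)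
  also have "\<dots> \<le> 61 / 60 * (1 / 60)" using Q by simp
  finally have d: "K * (K + \<epsilon>) * ((2 / 5) ^ m * exp (3 * \<rho>)) \<le> 61 / 60 * (1 / 60)" .
  have "25 * K * (K + \<epsilon>) * (2 / 5) ^ m * exp (3 * \<rho>)
      = 25 * (K * (K + \<epsilon>) * ((2 / 5) ^ m * exp (3 * \<rho>)))" by simp
  then show "(1 / sqrt 2 + \<epsilon>)\<^sup>2 + 25 * K * (K + \<epsilon>) * (2 / 5) ^ m * exp (3 * \<rho>) < 1"
    using a b d sq by (simp add: power2_eq_square)
qed

section \<open>Choice of the windows\<close>

lemma integral_power_div_fact:
  fixes L s :: real
  assumes "L > 0" "s \<ge> 0"
  shows "integral {0..s} (\<lambda>\<sigma>. (L * \<sigma>) ^ n / fact n) = (L * s) ^ Suc n / fact (Suc n) / L"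
proof -
  have "((\<lambda>\<sigma>. (L * \<sigma>) ^ n / fact n) has_integral
      (L * s) ^ Suc n / fact (Suc n) / L - (L * 0) ^ Suc n / fact (Suc n) / L) {0..s}"
  proof (rule fundamental_theorem_of_calculus[OF assms(2)])
    fix x assume "x \<in> {0..s}"
    have "((\<lambda>\<sigma>. (L * \<sigma>) ^ Suc n / fact (Suc n) / L) has_real_derivative
        ((1 + real n) * (L * (L * x) ^ n)) / fact (Suc n) / L) (at x within {0..s})"
      by (intro DERIV_cdivide DERIV_power_Suc DERIV_cmult_Id)
    also have "((1 + real n) * (L * (L * x) ^ n)) / fact (Suc n) / L = (L * x) ^ n / fact n"
      using assms(1) by (simp add: fact_Suc)
    finally show "((\<lambda>\<sigma>. (L * \<sigma>) ^ Suc n / fact (Suc n) / L) has_vector_derivative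
        (L * x) ^ n / fact n) (at x within {0..s})"
      by (simp add: has_real_derivative_iff_has_vector_derivative)
  qed
  from integral_unique[OF this] show ?thesis by simp
qed

lemma integral_exp_scaled:
  fixes a s :: real
  assumes "a > 0" "s \<ge> 0"
  shows "integral {0..s} (\<lambda>\<sigma>. exp (a * \<sigma>)) = (exp (a * s) - 1) / a"
proof -
  have "((\<lambda>\<sigma>. exp (a * \<sigma>)) has_integral exp (a * s) / a - exp (a * 0) / a) {0..s}"
    using assms
    by (intro fundamental_theorem_of_calculus)
      (auto intro!: derivative_eq_intros simp flip: has_real_derivative_iff_has_vector_derivative)
  then show ?thesis by (simp add: integral_unique diff_divide_distrib)
qed

lemma two_power_le_fact: "2 ^ n \<le> (2 * fact n :: real)"
proof (induction n)
  case (Suc n)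
  show ?case
  proof (cases n)
    case (Suc k)
    have "2 ^ Suc n = 2 * (2 ^ n :: real)" by simp
    also have "\<dots> \<le> real (Suc n) * (2 * fact n)"
      using Suc.IH Suc by (intro mult_mono) auto
    finally show ?thesis by (simp add: algebra_simps)
  qed simp
qed simp

context polynomial_field begin

text \<open>The bounds are terms of the exponential series, which the operator \<open>L\<close>
  times integration shifts by one. They stay below 2 because \<open>2 ^ n \<le> 2 * fact n\<close>.
  No time in \<open>{0..\<delta>}\<close> lies past the window, so \<open>C'\<close> may equal
  \<open>C\<close>.\<close>

lemma windowed_picard_constant:
  assumes "L * \<delta> \<le> 2"
  defines "u \<equiv> \<lambda>j s. (L * s) ^ Suc j / fact (Suc j)"
  shows "windowed_picard f f' c q L K r \<delta> (\<lambda>_. \<delta>) (\<lambda>j s. K * u j s) (\<lambda>j s. L * u j s) (\<lambda>j s. L * u j s)"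
proof unfold_locales
  fix j and s :: real
  have int: "L * integral {0..s} (u j) = u (Suc j) s" if "s \<ge> 0" for s
    unfolding u_def using integral_power_div_fact[OF L that, of "Suc j"] L by simp
  show "0 \<le> \<delta>" using \<delta> by simp
  show "continuous_on {0..\<delta>} (\<lambda>s. K * u j s)" "continuous_on {0..\<delta>} (\<lambda>s. L * u j s)"
    unfolding u_def by (auto intro!: continuous_intros)
  show "K * L * s \<le> K * u 0 s" by (simp add: u_def)
  show "L\<^sup>2 * s \<le> L * u 0 s" by (simp add: u_def power2_eq_square)
  assume s: "0 \<le> s" "s \<le> \<delta>"
  show "L * integral {0..s} (\<lambda>s. K * u j s) \<le> K * u (Suc j) s"
    "L * integral {0..s} (\<lambda>s. L * u j s) \<le> L * u (Suc j) s"
    using int[OF s(1)] by (simp_all add: mult.left_commute)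
  have "L * s \<le> 2" using s L assms(1) by (meson mult_left_mono less_imp_le order_trans)
  then have "(L * s) ^ Suc j \<le> 2 ^ Suc j" using s L by (intro power_mono) auto
  then have "(L * s) ^ Suc j \<le> 2 * fact (Suc j)" using two_power_le_fact[of "Suc j"] by linarith
  then have "u j s \<le> 2" unfolding u_def by (subst pos_divide_le_eq) auto
  then show "K * u j s \<le> 2 * K" using K by simp
qed auto

text \<open>The window ends when \<open>exp (3 * L * s)\<close> reaches \<open>3 ^ Suc j\<close>,
  that is when \<open>B j\<close> reaches \<open>K\<close>. Integration times \<open>L\<close> gains
  a factor \<open>1 / 3\<close>: the ratio of successive \<open>B j\<close>, and
  \<open>5 / 6\<close> of the ratio \<open>2 / 5\<close> of successive \<open>C j\<close>. The spare
  sixth of \<open>C j\<close> at \<open>t j\<close> is \<open>3 * K * L * (6 / 5) ^ j\<close>,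
  enough for the jump.\<close>

lemma windowed_picard_linear:
  defines "t \<equiv> \<lambda>j. real (Suc j) * ln 3 / (3 * L)"
    and "C \<equiv> \<lambda>j s. 6 * K * L * (2 / 5) ^ j * exp (3 * L * s)"
  shows "windowed_picard f f' c q L K r \<delta> t (\<lambda>j s. K * exp (3 * L * s) / 3 ^ Suc j) C (\<lambda>j s. 5 / 6 * C j s)"
proof unfold_locales
  fix j and s :: real
  have exp_t: "exp (3 * L * t j) = 3 ^ Suc j"
  proof -
    have "3 * L * t j = real (Suc j) * ln 3" using L by (simp add: t_def)
    then show ?thesis by (simp only: exp_of_nat_mult exp_ln)
  qed
  have int: "integral {0..s} (\<lambda>\<sigma>. exp (3 * L * \<sigma>)) = (exp (3 * L * s) - 1) / (3 * L)" if "s \<ge> 0" for s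
    using integral_exp_scaled[of "3 * L" s] L that by simp
  show "0 \<le> t j" using L by (simp add: t_def)
  show "continuous_on {0..\<delta>} (\<lambda>s. K * exp (3 * L * s) / 3 ^ Suc j)" "continuous_on {0..\<delta>} (C j)"
    unfolding C_def by (auto intro!: continuous_intros)
  { assume s: "0 \<le> s" "s \<le> \<delta>"
    have e: "3 * L * s \<le> exp (3 * L * s)"
      using exp_ge_add_one_self[of "3 * L * s"] by linarith
    have "K * (3 * L * s) \<le> K * exp (3 * L * s)" using e K by (intro mult_left_mono) auto
    then show "K * L * s \<le> K * exp (3 * L * s) / 3 ^ Suc 0" by (simp add: algebra_simps)
    have "L\<^sup>2 * s \<le> 5 * L * (3 * L * s)"
      using s L by (simp add: power2_eq_square)
    also have "\<dots> \<le> 5 * (K * L) * exp (3 * L * s)"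
      using e s L K by (intro mult_mono) auto
    finally show "L\<^sup>2 * s \<le> 5 / 6 * C 0 s" by (simp add: C_def)
    have "L * integral {0..s} (\<lambda>s. K * exp (3 * L * s) / 3 ^ Suc j)
        = K / 3 ^ Suc (Suc j) * (exp (3 * L * s) - 1)"
    proof -
      have "integral {0..s} (\<lambda>s. K * exp (3 * L * s) / 3 ^ Suc j)
          = integral {0..s} (\<lambda>s. K / 3 ^ Suc j * exp (3 * L * s))" by simp
      also have "\<dots> = K / 3 ^ Suc j * ((exp (3 * L * s) - 1) / (3 * L))"
        unfolding integral_mult_right int[OF s(1)] ..
      finally show ?thesis using L by simp
    qed
    also have "\<dots> \<le> K / 3 ^ Suc (Suc j) * exp (3 * L * s)"
      using K by (intro mult_left_mono) auto
    finally show "L * integral {0..s} (\<lambda>s. K * exp (3 * L * s) / 3 ^ Suc j)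
        \<le> K * exp (3 * L * s) / 3 ^ Suc (Suc j)" by simp
    have "L * integral {0..s} (C j) = 2 * K * L * (2 / 5) ^ j * (exp (3 * L * s) - 1)"
      using int[OF s(1)] L by (simp add: C_def)
    also have "\<dots> \<le> 2 * K * L * (2 / 5) ^ j * exp (3 * L * s)"
      using K L by (intro mult_left_mono) auto
    finally show "L * integral {0..s} (C j) \<le> 5 / 6 * C (Suc j) s" by (simp add: C_def)
    show "5 / 6 * C j s \<le> C j s" using K L by (simp add: C_def)
    assume "s \<le> t j"
    then have "exp (3 * L * s) \<le> exp (3 * L * t j)" using L by simp
    then have "exp (3 * L * s) \<le> 3 ^ Suc j" unfolding exp_t .
    then have "K * exp (3 * L * s) \<le> K * 3 ^ Suc j" using K by (intro mult_left_mono) auto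
    then have "K * exp (3 * L * s) / 3 ^ Suc j \<le> K" by (subst pos_divide_le_eq) auto
    then show "K * exp (3 * L * s) / 3 ^ Suc j \<le> 2 * K" using K by linarith }
  { assume s: "t j < s" "s \<le> \<delta>"
    then have "exp (3 * L * t j) \<le> exp (3 * L * s)" using L by simp
    then have e: "3 ^ Suc j \<le> exp (3 * L * s)" unfolding exp_t .
    then have "K * 3 ^ Suc j \<le> K * exp (3 * L * s)" using K by (intro mult_left_mono) auto
    then show "K \<le> K * exp (3 * L * s) / 3 ^ Suc j" by (subst pos_le_divide_eq) auto
    have "3 * K * L * 1 \<le> 3 * K * L * (6 / 5) ^ j"
      using K L by (intro mult_left_mono one_le_power) auto
    also have "\<dots> = C j (t j) / 6"
      unfolding C_def exp_t by (simp add: power_divide flip: power_mult_distrib)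
    finally have "5 / 6 * C j (t j) + 3 * K * L \<le> C j (t j)" by simp
    also have "\<dots> \<le> C j s"
      unfolding C_def exp_t using e K L by (intro mult_left_mono) auto
    finally show "5 / 6 * C j (t j) + 3 * K * L \<le> C j s" . }
qed

end

section \<open>Consequences of stability and of the degree bound\<close>

text \<open>A trajectory cannot decay faster than \<open>exp (- L * t)\<close>, because
  \<open>(norm (\<phi> t))\<^sup>2 * exp (2 * L * t)\<close> is nondecreasing.\<close>

lemma decay_rate_le_lipschitz:
  fixes \<phi> :: "real \<Rightarrow> 'a::real_inner"
  assumes \<phi>': "\<And>t. t \<ge> 0 \<Longrightarrow> (\<phi> has_vector_derivative f (\<phi> t)) (at t within {0..})"
    and f: "\<And>t. t \<ge> 0 \<Longrightarrow> norm (f (\<phi> t)) \<le> L * norm (\<phi> t)"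
    and decay: "\<And>t. t \<ge> 0 \<Longrightarrow> norm (\<phi> t) \<le> K * norm (\<phi> 0) * exp (- lam * t)"
    and "\<phi> 0 \<noteq> 0"
  shows "lam \<le> L"
proof (rule ccontr)
  assume "\<not> lam \<le> L"
  then have lam: "lam > L" by simp
  have "norm (\<phi> 0) * 1 \<le> norm (\<phi> 0) * K" using decay[of 0] by (simp add: mult.commute)
  then have K: "K \<ge> 1" using \<open>\<phi> 0 \<noteq> 0\<close> by simp
  \<comment> \<open>Chosen so that \<open>K * exp (- (lam - L) * T) = 1 / 2\<close>, which
    contradicts the monotonicity.\<close>
  define T where "T = ln (2 * K) / (lam - L)"
  have T: "T \<ge> 0" using K lam by (simp add: T_def)
  define u where "u t = (\<phi> t \<bullet> \<phi> t) * exp (2 * L * t)" for t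
  have "u 0 \<le> u T"
  proof (rule DERIV_nonneg_imp_increasing_open[OF T])
    fix t assume t: "0 < t" "t < T"
    have "at t within {0..} = at t" using t by (intro at_within_interior) simp
    then have d: "(\<phi> has_derivative (\<lambda>h. h *\<^sub>R f (\<phi> t))) (at t)"
      using \<phi>'[of t] t by (simp add: has_vector_derivative_def)
    have "((\<lambda>t. \<phi> t \<bullet> \<phi> t) has_real_derivative 2 * (\<phi> t \<bullet> f (\<phi> t))) (at t)"
      unfolding has_field_derivative_def
      by (rule has_derivative_eq_rhs[OF has_derivative_inner[OF d d]])
        (auto simp: inner_commute algebra_simps)
    then have "(u has_real_derivative
        2 * (\<phi> t \<bullet> f (\<phi> t)) * exp (2 * L * t) + exp (2 * L * t) * (2 * L) * (\<phi> t \<bullet> \<phi> t)) (at t)"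
      unfolding u_def by (auto intro!: derivative_eq_intros simp: algebra_simps)
    moreover have "0 \<le> 2 * (\<phi> t \<bullet> f (\<phi> t)) * exp (2 * L * t) + exp (2 * L * t) * (2 * L) * (\<phi> t \<bullet> \<phi> t)"
    proof -
      have "- (\<phi> t \<bullet> f (\<phi> t)) \<le> norm (\<phi> t) * norm (f (\<phi> t))"
        using Cauchy_Schwarz_ineq2[of "\<phi> t" "f (\<phi> t)"] by linarith
      also have "\<dots> \<le> norm (\<phi> t) * (L * norm (\<phi> t))" using f t by (intro mult_left_mono) auto
      also have "\<dots> = L * (\<phi> t \<bullet> \<phi> t)" by (simp add: dot_square_norm power2_eq_square)
      finally have "0 \<le> 2 * exp (2 * L * t) * (\<phi> t \<bullet> f (\<phi> t) + L * (\<phi> t \<bullet> \<phi> t))" by simp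
      then show ?thesis by (simp add: algebra_simps)
    qed
    ultimately show "\<exists>y. (u has_real_derivative y) (at t) \<and> 0 \<le> y" by blast
  next
    have "continuous_on {0..} \<phi>"
      unfolding continuous_on_eq_continuous_within using \<phi>' has_vector_derivative_continuous by blast
    then show "continuous_on {0..T} u"
      unfolding u_def by (intro continuous_intros continuous_on_subset[OF \<open>continuous_on {0..} \<phi>\<close>]) auto
  qed
  moreover have "u 0 = (norm (\<phi> 0))\<^sup>2" by (simp add: u_def dot_square_norm)
  moreover have "u T = (norm (\<phi> T) * exp (L * T))\<^sup>2"
    by (simp add: u_def dot_square_norm power_mult_distrib exp_double[symmetric] mult.assoc)
  ultimately have "(norm (\<phi> 0))\<^sup>2 \<le> (norm (\<phi> T) * exp (L * T))\<^sup>2" by simp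
  then have "norm (\<phi> 0) \<le> norm (\<phi> T) * exp (L * T)" by (rule power2_le_imp_le) simp
  also have "\<dots> \<le> K * norm (\<phi> 0) * exp (- lam * T) * exp (L * T)"
    using decay[OF T] by (intro mult_right_mono) auto
  also have "\<dots> = K * norm (\<phi> 0) * exp (- ((lam - L) * T))"
    by (simp add: mult.assoc algebra_simps flip: exp_add)
  also have "(lam - L) * T = ln (2 * K)" using lam by (simp add: T_def)
  also have "K * norm (\<phi> 0) * exp (- ln (2 * K)) = norm (\<phi> 0) / 2"
    using K by (simp add: exp_minus field_simps)
  finally show False using \<open>\<phi> 0 \<noteq> 0\<close> by simp
qed


text \<open>Everything is monotone in the step length, so \<open>T\<close> may be replaced by the
  smaller \<open>\<delta> / N\<close>. What remains depends on \<open>L\<close> and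
  \<open>\<delta>\<close> only through their product.\<close>

lemma bounds_from_degree_bound:
  fixes K L T \<delta> :: real and N k :: nat
  defines "c \<equiv> picard_error K L T N k" and "\<alpha> \<equiv> L * \<delta> / N"
  assumes K: "K \<ge> 1" and L: "L > 0" and T: "T > 0" "T < 1 / (2 * L)" and \<delta>: "\<delta> > 0" "N * T > \<delta>"
    and c: "c < K" and small: "c\<^sup>2 + \<delta> * K * ((T * L) ^ k / T) * (1 + c) * (K + c) < 1 / 2"
  defines "x \<equiv> K\<^sup>2 * \<alpha> ^ k * N"
  shows "N \<ge> 1" "k \<ge> 1" "\<alpha> < 1 / 2" "K\<^sup>2 * \<alpha> ^ k * (\<Sum>i<N. exp \<alpha> ^ i) \<le> c" "c\<^sup>2 < 1 / 2"
    "x\<^sup>2 + x * (1 + x) * (1 + x / K) < 1 / 2"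
proof -
  show N: "N \<ge> 1" using \<delta> T by (cases N) auto
  have \<alpha>0: "\<alpha> > 0" using L \<delta> N by (simp add: \<alpha>_def)
  have "L * \<delta> < L * (N * T)" using \<delta> L by simp
  then have \<alpha>T: "\<alpha> < T * L" using N by (simp add: \<alpha>_def pos_divide_less_eq mult_ac)
  have "T * L < 1 / (2 * L) * L" using T L by (intro mult_strict_right_mono) auto
  then have "T * L < 1 / 2" using L by simp
  with \<alpha>T show "\<alpha> < 1 / 2" by simp
  have \<alpha>k: "\<alpha> ^ k \<le> (T * L) ^ k" using \<alpha>T \<alpha>0 by (intro power_mono) auto
  have pos: "K * (T * L) ^ k \<ge> 0" using K T L by simp
  have "K\<^sup>2 * \<alpha> ^ k * (\<Sum>i<N. exp \<alpha> ^ i) = (\<Sum>i<N. exp \<alpha> ^ i * (K\<^sup>2 * \<alpha> ^ k))"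
    by (simp add: sum_distrib_left mult_ac)
  also have "\<dots> \<le> (\<Sum>i<N. (exp (T * L) + K * (T * L) ^ k) ^ i * (K\<^sup>2 * (T * L) ^ k))"
  proof (intro sum_mono mult_mono power_mono)
    have "exp \<alpha> \<le> exp (T * L)" using \<alpha>T by simp
    then show "exp \<alpha> \<le> exp (T * L) + K * (T * L) ^ k" using pos by linarith
  qed (use \<alpha>k \<alpha>0 \<alpha>T K pos in \<open>auto intro!: zero_le_power add_nonneg_nonneg\<close>)
  also have "\<dots> = c" by (simp add: c_def picard_error_def mult_ac)
  finally show sum_c: "K\<^sup>2 * \<alpha> ^ k * (\<Sum>i<N. exp \<alpha> ^ i) \<le> c" .
  have "(\<Sum>i<N. 1) \<le> (\<Sum>i<N. exp \<alpha> ^ i)" using \<alpha>0 by (intro sum_mono one_le_power) auto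
  then have "K\<^sup>2 * \<alpha> ^ k * N \<le> K\<^sup>2 * \<alpha> ^ k * (\<Sum>i<N. exp \<alpha> ^ i)"
    using \<alpha>0 by (intro mult_left_mono) auto
  with sum_c have xc: "x \<le> c" by (simp add: x_def)
  have x0: "x \<ge> 0" using \<alpha>0 by (simp add: x_def)
  show k: "k \<ge> 1"
  proof (rule ccontr)
    assume "\<not> k \<ge> 1"
    then have "k = 0" by simp
    \<comment> \<open>For \<open>k = 0\<close> the quantity \<open>x\<close> is
      \<open>K\<^sup>2 * N\<close>, too large for \<open>x \<le> c < K\<close>.\<close>
    then have "K * (K * 1) \<le> x" using N K by (simp add: x_def power2_eq_square mult_left_mono)
    moreover have "K * 1 \<le> K * K" using K by (intro mult_left_mono) auto
    ultimately show False using xc c by simp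
  qed
  have S: "x * (1 + x) * (1 + x / K) \<le> \<delta> * K * ((T * L) ^ k / T) * (1 + c) * (K + c)"
  proof -
    obtain l where l: "k = Suc l" using k by (cases k) auto
    \<comment> \<open>One factor \<open>\<alpha>\<close> absorbs \<open>N\<close>, leaving
      \<open>L * \<delta>\<close>; only the other \<open>k - 1\<close> factors are enlarged to
      \<open>T * L\<close>, which produces \<open>(T * L) ^ k / T\<close>.\<close>
    have "\<alpha> ^ k * N = L * \<delta> * \<alpha> ^ l" using N by (simp add: l \<alpha>_def)
    also have "\<dots> \<le> L * \<delta> * (T * L) ^ l"
      using \<alpha>T \<alpha>0 L \<delta> by (intro mult_left_mono power_mono) auto
    also have "\<dots> = \<delta> * ((T * L) ^ k / T)" using T by (simp add: l)
    finally have "K\<^sup>2 * (\<alpha> ^ k * N) \<le> K\<^sup>2 * (\<delta> * ((T * L) ^ k / T))" by (intro mult_left_mono) auto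
    then have xw: "x \<le> K\<^sup>2 * (\<delta> * ((T * L) ^ k / T))" by (simp only: x_def mult.assoc)
    have "x * (1 + x) * (1 + x / K) \<le> K\<^sup>2 * (\<delta> * ((T * L) ^ k / T)) * (1 + c) * (1 + c / K)"
      using x0 xc K by (intro mult_mono' xw) (auto intro!: divide_right_mono)
    also have "\<dots> = \<delta> * K * ((T * L) ^ k / T) * (1 + c) * (K * (1 + c / K))"
      by (simp add: power2_eq_square mult_ac)
    also have "K * (1 + c / K) = K + c" using K by (simp add: algebra_simps)
    finally show ?thesis .
  qed
  have "x\<^sup>2 \<le> c\<^sup>2" using x0 xc by (intro power_mono) auto
  then show "x\<^sup>2 + x * (1 + x) * (1 + x / K) < 1 / 2" using S small by linarith
  have "0 \<le> x * (1 + x) * (1 + x / K)" using x0 K by simp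
  then show "c\<^sup>2 < 1 / 2" using S small by linarith
qed

lemma solution_from_has_integral:
  assumes "solution_from f x0 \<phi>" "s \<ge> 0"
  shows "((\<lambda>\<sigma>. f (\<phi> \<sigma>)) has_integral \<phi> s - x0) {0..s}"
proof -
  have "(\<phi> has_vector_derivative f (\<phi> \<sigma>)) (at \<sigma> within {0..s})" if "\<sigma> \<in> {0..s}" for \<sigma>
    by (rule has_vector_derivative_within_subset[where S = "{0..}"])
      (use assms that in \<open>auto simp: solution_from_def\<close>)
  from fundamental_theorem_of_calculus[OF assms(2) this] show ?thesis
    using assms(1) by (simp add: solution_from_def)
qed

lemma quadratic_form_zero [simp]: "z \<in> carrier_vec D \<Longrightarrow> quadratic_form (0\<^sub>m D D) z = 0"
  by (auto simp: quadratic_form_def scalar_prod_def)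

theorem theorem13:
  fixes f :: "real ^ 'n::finite \<Rightarrow> real ^ 'n"
    and M :: "(real ^ 'n) set"
    and r lam K :: real
    and q d D :: nat
    and e :: "nat \<Rightarrow> 'n \<Rightarrow> nat"
  assumes "polynomial_field_of_degree q f"
    and "f 0 = 0"
    and "r > 0"
    and "M \<noteq> {}"
    and "M \<subseteq> cball 0 r"
    and "lam > 0"
    and "K \<ge> 1"
    and "degree_bound f q r K lam (2 * d)"
    and "D = fact (CARD('n) + d) div (fact CARD('n) * fact d)"
    and "bij_betw e {..<D} (exponents d)"
    and "exp_stable_on f M K lam"
  shows "\<exists>\<alpha>>0. \<exists>\<beta>>0. \<exists>\<gamma>>0. \<exists>P\<in>carrier_mat D D.
           transpose_mat P = P \<and> psd_mat D P \<and>
           (\<forall>x\<in>M. \<alpha> * (norm x)\<^sup>2 \<le> quadratic_form P (monomial_vec D e x) \<and>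
                  quadratic_form P (monomial_vec D e x) \<le> \<beta> * (norm x)\<^sup>2) \<and>
           (\<forall>x\<in>M. \<exists>g. GDERIV (\<lambda>y. quadratic_form P (monomial_vec D e y)) x :> g \<and>
                  g \<bullet> f x \<le> - \<gamma> * (norm x)\<^sup>2)"
proof (cases "M \<subseteq> {0}")
  case True
  \<comment> \<open>At \<open>x = 0\<close> all conditions hold for \<open>P = 0\<close>. Otherwise
    \<open>M\<close> contains a nonzero point, on whose trajectory the comparison of
    \<open>lam\<close> with \<open>L\<close> rests.\<close>
  have z: "monomial_vec D e x \<in> carrier_vec D" for x by (simp add: monomial_vec_def)
  have "psd_mat D (0\<^sub>m D D)"
    using quadratic_form_zero unfolding psd_mat_def quadratic_form_def by auto
  moreover have "x = 0" if "x \<in> M" for x using that True by auto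
  ultimately show ?thesis
    by (intro exI[of _ 1] conjI bexI[of _ "0\<^sub>m D D"] ballI exI[of _ 0])
      (auto simp: z intro: GDERIV_const)
next
  case False
  then obtain x1 where x1: "x1 \<in> M" "x1 \<noteq> 0" by blast
  obtain c where f_poly: "\<And>x. f x = (\<Sum>a\<in>exponents q. monomial a x *\<^sub>R c a)"
    using assms(1) unfolding polynomial_field_of_degree_def by blast
  obtain L T N k where L: "L > 0" and lip: "L-lipschitz_on (cball 0 (4 * K * r)) f"
    and T: "T > 0" "T < 1 / (2 * L)" and NT: "real N * T > ln (2 * K\<^sup>2) / (2 * lam)"
    and pe: "picard_error K L T N k < K"
      "(picard_error K L T N k)\<^sup>2 + ln (2 * K\<^sup>2) / (2 * lam) * K * ((T * L) ^ k / T)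
              * (1 + picard_error K L T N k) * (K + picard_error K L T N k) < 1 / 2"
    and d: "d = q ^ (N * k - 1)"
    using assms(8) unfolding degree_bound_def by auto
  define \<delta> where "\<delta> = ln (2 * K\<^sup>2) / (2 * lam)"
  define \<rho> where "\<rho> = L * \<delta>"
  have K: "K \<ge> 1" by fact
  have K2: "K\<^sup>2 \<ge> 1" using K by simp
  then have lnK: "ln (2 * K\<^sup>2) \<ge> 2 / 3"
    using ln2_ge_two_thirds ln_mono[of 2 "2 * K\<^sup>2"] by simp
  then have \<delta>: "\<delta> > 0" using \<open>lam > 0\<close> by (simp add: \<delta>_def)
  have f_le: "norm (f y) \<le> L * norm y" if "norm y \<le> 4 * K * r" for y
    using lipschitz_onD[OF lip, of y 0] that K \<open>r > 0\<close> \<open>f 0 = 0\<close> by simp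
  have solution: "\<exists>\<phi>. solution_from f x \<phi> \<and> (\<forall>t\<ge>0. norm (\<phi> t) \<le> K * norm x * exp (- lam * t) \<and>
      norm (\<phi> t) \<le> K * norm x \<and> norm (f (\<phi> t)) \<le> L * norm (\<phi> t))"
    if x: "x \<in> M" for x
  proof -
    obtain \<phi> where \<phi>: "solution_from f x \<phi>" "\<And>t. t \<ge> 0 \<Longrightarrow> norm (\<phi> t) \<le> K * norm x * exp (- lam * t)"
      using assms(11) x unfolding exp_stable_on_def by blast
    have le: "norm (\<phi> t) \<le> K * norm x" if "t \<ge> 0" for t
    proof -
      have "K * norm x * exp (- lam * t) \<le> K * norm x * 1"
        using that \<open>lam > 0\<close> K by (intro mult_left_mono) auto
      then show ?thesis using \<phi>(2)[OF that] by simp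
    qed
    have "K * norm x \<le> K * r" using x assms(5) K by (intro mult_left_mono) auto
    moreover have "K * r > 0" using K \<open>r > 0\<close> by simp
    ultimately have "norm (\<phi> t) \<le> 4 * K * r" if "t \<ge> 0" for t using le[OF that] by linarith
    then show ?thesis using \<phi> le f_le by blast
  qed
  obtain \<phi>1 where \<phi>1: "solution_from f x1 \<phi>1" "\<And>t. t \<ge> 0 \<Longrightarrow> norm (\<phi>1 t) \<le> K * norm x1 * exp (- lam * t)"
      "\<And>t. t \<ge> 0 \<Longrightarrow> norm (f (\<phi>1 t)) \<le> L * norm (\<phi>1 t)"
    using solution[OF x1(1)] by blast
  \<comment> \<open>Applied twice: with \<open>L' = 0\<close> it excludes a constant field, and with
    \<open>L' = L\<close> it gives \<open>\<rho> \<ge> lam * \<delta> = ln (2 * K\<^sup>2) / 2 \<ge>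
    1 / 3\<close>.\<close>
  have lam_le: "lam \<le> L'" if "\<And>t. t \<ge> 0 \<Longrightarrow> norm (f (\<phi>1 t)) \<le> L' * norm (\<phi>1 t)" for L'
    using decay_rate_le_lipschitz[of \<phi>1 f L' K lam] \<phi>1(1,2) x1(2) that
    by (auto simp: solution_from_def)
  have q: "q \<ge> 1"
  proof (rule ccontr)
    assume "\<not> q \<ge> 1"
    then have "q = 0" by simp
    then have "exponents q = {\<lambda>_::'n. 0}" by (auto simp: exponents_def fun_eq_iff)
    then have "f y = f 0" for y using f_poly by simp
    then have "f y = 0" for y using \<open>f 0 = 0\<close> by metis
    then have "lam \<le> 0" using lam_le[of 0] by simp
    then show False using \<open>lam > 0\<close> by simp
  qed
  have "\<rho> \<ge> lam * \<delta>" unfolding \<rho>_def using lam_le[OF \<phi>1(3)] \<delta> by simp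
  moreover have "lam * \<delta> = ln (2 * K\<^sup>2) / 2" using \<open>lam > 0\<close> by (simp add: \<delta>_def)
  ultimately have \<rho>3: "\<rho> \<ge> 1 / 3" using lnK by linarith
  have decay: "K * exp (- lam * \<delta>) = 1 / sqrt 2"
  proof -
    have "exp (lam * \<delta>) = sqrt 2 * K"
    proof (rule power2_eq_imp_eq)
      have "(exp (lam * \<delta>))\<^sup>2 = exp (ln (2 * K\<^sup>2))"
        unfolding \<open>lam * \<delta> = _\<close> by (simp flip: exp_double)
      then show "(exp (lam * \<delta>))\<^sup>2 = (sqrt 2 * K)\<^sup>2" using K by (simp add: power_mult_distrib)
    qed (use K in auto)
    then show ?thesis using K by (simp add: exp_minus field_simps)
  qed
  define f' where "f' y = frechet_derivative f (at y)" for y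
  have "poly_family q (\<lambda>x s. f x)"
    using poly_family_compose[OF f_poly poly_family_identity] by simp
  from poly_family_has_derivative[OF this, of 0]
  have f': "(f has_derivative f' y) (at y)" for y by (simp add: f'_def)
  interpret polynomial_field f f' c q L K r \<delta>
    by unfold_locales (use f_poly q f' assms lip L \<delta> in auto)
  have trajectory: "\<exists>\<phi>. (\<forall>s\<ge>0. ((\<lambda>\<sigma>. f (\<phi> \<sigma>)) has_integral \<phi> s - x) {0..s} \<and>
        norm (\<phi> s) \<le> K * norm x) \<and> norm (\<phi> \<delta>) \<le> 1 / sqrt 2 * norm x" if x: "x \<in> M" for x
  proof -
    obtain \<phi> where \<phi>: "solution_from f x \<phi>" "\<And>t. t \<ge> 0 \<Longrightarrow> norm (\<phi> t) \<le> K * norm x * exp (- lam * t)"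
        "\<And>t. t \<ge> 0 \<Longrightarrow> norm (\<phi> t) \<le> K * norm x"
      using solution[OF x] by blast
    have "norm (\<phi> \<delta>) \<le> K * exp (- lam * \<delta>) * norm x"
      using \<phi>(2)[of \<delta>] \<delta> by (simp add: mult_ac)
    then have "norm (\<phi> \<delta>) \<le> 1 / sqrt 2 * norm x" unfolding decay .
    then show ?thesis using solution_from_has_integral[OF \<phi>(1)] \<phi>(3) by blast
  qed
  note bounds = bounds_from_degree_bound[OF K L T \<delta> NT[folded \<delta>_def] pe[folded \<delta>_def], folded \<rho>_def]
  define m where "m = N * k"
  show ?thesis
  proof (cases "\<rho> \<le> 2")
    case True
    define \<tau> where "\<tau> = \<rho> ^ m / fact m"
    note num = short_time_error[OF K \<rho>3 True bounds(1,3,2,6) refl refl, folded m_def, folded \<tau>_def]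
    have m2: "1 * 2 \<le> m" unfolding m_def using bounds(1) num(1) by (intro mult_mono) auto
    \<comment> \<open>The iterate used is \<open>Suc i = N * k - 1\<close>, of degree at most
      \<open>d\<close>. Its error bound and the integral of \<open>C i\<close> then both carry the
      exponent \<open>m\<close>.\<close>
    define i where "i = m - 2"
    have i: "m = Suc (Suc i)" using m2 by (simp add: i_def)
    let ?u = "\<lambda>j s. (L * s) ^ Suc j / fact (Suc j)"
    interpret windowed_picard f f' c q L K r \<delta> "\<lambda>_. \<delta>" "\<lambda>j s. K * ?u j s" "\<lambda>j s. L * ?u j s"
        "\<lambda>j s. L * ?u j s"
      by (rule windowed_picard_constant) (use True in \<open>simp add: \<rho>_def\<close>)
    have I: "integral {0..\<delta>} (\<lambda>s. L * ?u i s) = \<tau>"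
      using integral_power_div_fact[of L \<delta> "Suc i"] L \<delta> unfolding integral_mult_right \<tau>_def i \<rho>_def
      by simp
    have B: "K * ?u (Suc i) s \<le> K * \<tau>" if "0 \<le> s" "s \<le> \<delta>" for s
      unfolding \<tau>_def i \<rho>_def using that K L
      by (intro mult_left_mono divide_right_mono power_mono) auto
    have \<tau>0: "K * \<tau> \<ge> 0" using \<rho>3 K by (simp add: \<tau>_def)
    have e: "bij_betw e {..<D} (exponents (q ^ Suc i))"
      using assms(10) unfolding d m_def[symmetric] i by simp
    have small: "(1 / sqrt 2 + K * \<tau>)\<^sup>2 + 2 * (K + K * \<tau>) * integral {0..\<delta>} (\<lambda>s. L * ?u i s) < 1"
      unfolding I by (rule num(2))
    show ?thesis
      by (rule exists_certificate[OF e assms(5) trajectory B \<tau>0 small])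
  next
    case False
    then have \<rho>2: "\<rho> \<ge> 2" by simp
    define \<epsilon> where "\<epsilon> = K * exp (3 * \<rho>) / 3 ^ m"
    have m: "real m \<ge> 2.7 * \<rho> * (\<rho> + 2 * ln K + 0.6)"
      using long_time_iterations[OF K \<rho>2 bounds(1,3,4,5)] unfolding m_def by simp
    note num = long_time_error[OF K \<rho>2 m \<epsilon>_def]
    define i where "i = m - 2"
    have i: "m = Suc (Suc i)" using num(1) by (simp add: i_def)
    let ?C = "\<lambda>j s. 6 * K * L * (2 / 5) ^ j * exp (3 * L * s)"
    interpret windowed_picard f f' c q L K r \<delta> "\<lambda>j. real (Suc j) * ln 3 / (3 * L)"
        "\<lambda>j s. K * exp (3 * L * s) / 3 ^ Suc j" ?C "\<lambda>j s. 5 / 6 * ?C j s"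
      by (rule windowed_picard_linear)
    have "integral {0..\<delta>} (?C i) = 2 * K * (2 / 5) ^ i * (exp (3 * \<rho>) - 1)"
      using integral_exp_scaled[of "3 * L" \<delta>] L \<delta> by (simp add: \<rho>_def mult.assoc)
    also have "\<dots> \<le> 2 * K * (2 / 5) ^ i * exp (3 * \<rho>)"
      using K by (intro mult_left_mono) auto
    finally have I: "integral {0..\<delta>} (?C i) \<le> 2 * K * (2 / 5) ^ i * exp (3 * \<rho>)" .
    have \<epsilon>0: "\<epsilon> \<ge> 0" using K by (simp add: \<epsilon>_def)
    have "2 * (K + \<epsilon>) * integral {0..\<delta>} (?C i) \<le> 2 * (K + \<epsilon>) * (2 * K * (2 / 5) ^ i * exp (3 * \<rho>))"
      using I K \<epsilon>0 by (intro mult_left_mono) auto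
    \<comment> \<open>Since \<open>i = m - 2\<close>, the constant is
      \<open>4 * (5 / 2)\<^sup>2 = 25\<close>.\<close>
    also have "\<dots> = 25 * K * (K + \<epsilon>) * (2 / 5) ^ m * exp (3 * \<rho>)"
      by (simp add: i)
    finally have small: "(1 / sqrt 2 + \<epsilon>)\<^sup>2 + 2 * (K + \<epsilon>) * integral {0..\<delta>} (?C i) < 1"
      using num by linarith
    have B: "K * exp (3 * L * s) / 3 ^ Suc (Suc i) \<le> \<epsilon>" if "0 \<le> s" "s \<le> \<delta>" for s
    proof -
      have "exp (3 * L * s) \<le> exp (3 * \<rho>)" using that L by (simp add: \<rho>_def)
      then show ?thesis unfolding \<epsilon>_def i using K by (intro divide_right_mono mult_left_mono) auto
    qed
    have e: "bij_betw e {..<D} (exponents (q ^ Suc i))"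
      using assms(10) unfolding d m_def[symmetric] i by simp
    show ?thesis
      by (rule exists_certificate[OF e assms(5) trajectory B \<epsilon>0 small])
  qed
qed

end
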